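(* Let $n\geq 3$ and let $X_1,\dots,X_n$ be a Markov chain of real-valued random variables (not assumed time-homogeneous) such that $(X_1,\dots,X_n)$ has an Archimedean copula with generator $\phi$. Then $X_1,\dots,X_n$ are independent.
   Context: An $n$-dimensional copula is the joint distribution function of an $n$-dimensional random vector all of whose univariate marginals are uniform on $[0,1]$. By Sklar's theorem, the joint distribution function $F$ of a random vector $(X_1,\dots,X_n)$ with marginal distribution functions $F_1,\dots,F_n$ can be written $F(x_1,\dots,x_n)=C(F_1(x_1),\dots,F_n(x_n))$ for some copula $C$, and $C$ is unique if $F$ is continuous; one then says that $(X_1,\dots,X_n)$ has the copula $C$. When the copula is not unique, all possible copulas agree at points $(u_1,\dots,u_n)$ with each $u_i$ in the range of $F_i$, and by convention "the copula" of $(X_1,\dots,X_n)$ is the one obtained from these values by interpolation that is linear in each coordinate. A copula is called Archimedean with generator $\phi$ if it has the form $\phi^{-1}(\phi(u_1)+\cdots+\phi(u_n))$, where $\psi=\phi^{-1}$ is a function on $[0,\infty)$ that is non-increasing, continuous, satisfies $\psi(0)=1$ and $\lim_{x\to\infty}\psi(x)=0$, and is strictly decreasing where $\psi>0$ (here $\phi(u)$ is the unique $x$ with $\psi(x)=u$ for $u\in(0,1]$, and $\phi(0)=\inf\{x:\psi(x)=0\}\in(0,\infty]$, with $\psi(\infty)=0$). It is part of the hypothesis that this expression is a copula, i.e. a distribution function on $[0,1]^n$. $X_1,\dots,X_n$ is a Markov chain if, for each $k$, the conditional law of $X_{k+1}$ given $(X_1,\dots,X_k)$ equals almost surely its conditional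 law given $X_k$. *)

theory Defs
  imports "HOL-Probability.Probability"
begin

text \<open>
  Vectors indexed by \<open>1, \<dots>, n\<close> are functions \<^typ>\<open>nat \<Rightarrow> real\<close>, of which only the values on
  \<open>{1..n}\<close> matter; a point of \<open>[0,1]^n\<close> is some \<open>u \<in> {1..n} \<rightarrow> {0..1}\<close>.
\<close>

definition joint_cdf :: "'a measure \<Rightarrow> nat \<Rightarrow> (nat \<Rightarrow> 'a \<Rightarrow> real) \<Rightarrow> (nat \<Rightarrow> real) \<Rightarrow> real" where
  "joint_cdf M n X x = measure M {\<omega> \<in> space M. \<forall>i\<in>{1..n}. X i \<omega> \<le> x i}"

abbreviation marginal_cdf :: "'a measure \<Rightarrow> ('a \<Rightarrow> real) \<Rightarrow> real \<Rightarrow> real" where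
  "marginal_cdf M Y \<equiv> cdf (distr M borel Y)"

text \<open>
  A copula is constrained on \<open>[0,1]^n\<close> only. The random vector with uniform marginals is taken, without
  loss of generality, to be the coordinate vector on \<open>\<real>^n\<close> under its law \<open>N\<close>.
\<close>

definition is_copula :: "nat \<Rightarrow> ((nat \<Rightarrow> real) \<Rightarrow> real) \<Rightarrow> bool" where
  "is_copula n C \<longleftrightarrow>
    (\<exists>N. prob_space N \<and> sets N = sets (Pi\<^sub>M {1..n} (\<lambda>_. borel :: real measure)) \<and>
      (\<forall>i\<in>{1..n}. distr N borel (\<lambda>x. x i) = uniform_measure lborel {0..1}) \<and>
      (\<forall>u \<in> {1..n} \<rightarrow> {0..1}. C u = joint_cdf N n (\<lambda>i x. x i) u))"

text \<open>
  The third conjunct is the interpolation convention for marginals with atoms: on any interval \<open>[a,b]\<close>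
  whose interior contains no value of the \<open>i\<close>-th marginal distribution function, \<open>C\<close> is affine in the
  \<open>i\<close>-th coordinate. It is void for continuous marginals. Together with Sklar's identity it
  determines \<open>C\<close> on \<open>[0,1]^n\<close>; see \<open>has_copula_unique\<close> below.
\<close>

definition has_copula ::
    "'a measure \<Rightarrow> nat \<Rightarrow> (nat \<Rightarrow> 'a \<Rightarrow> real) \<Rightarrow> ((nat \<Rightarrow> real) \<Rightarrow> real) \<Rightarrow> bool" where
  "has_copula M n X C \<longleftrightarrow>
    is_copula n C \<and>
    (\<forall>x. joint_cdf M n X x = C (\<lambda>i. marginal_cdf M (X i) (x i))) \<and>
    (\<forall>i\<in>{1..n}. \<forall>u \<in> {1..n} \<rightarrow> {0..1}. \<forall>a b t.
      0 \<le> a \<and> a < b \<and> b \<le> 1 \<and> {a<..<b} \<inter> range (marginal_cdf M (X i)) = {} \<and> t \<in> {0..1} \<longrightarrow>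
      C (u(i := (1 - t) * a + t * b)) = (1 - t) * C (u(i := a)) + t * C (u(i := b)))"

definition inverse_generator :: "(real \<Rightarrow> real) \<Rightarrow> bool" where
  "inverse_generator \<psi> \<longleftrightarrow>
    antimono_on {0..} \<psi> \<and> continuous_on {0..} \<psi> \<and> \<psi> 0 = 1 \<and> (\<psi> \<longlongrightarrow> 0) at_top \<and>
    strict_antimono_on {x. 0 \<le> x \<and> \<psi> x > 0} \<psi>"

text \<open>In the first case the infimum is \<open>\<infinity>\<close> if \<open>\<psi>\<close> has no zero.\<close>

definition generator_of :: "(real \<Rightarrow> real) \<Rightarrow> real \<Rightarrow> ennreal" where
  "generator_of \<psi> u =
    (if u = 0 then Inf {ennreal x | x. 0 \<le> x \<and> \<psi> x = 0}
     else ennreal (THE x. 0 \<le> x \<and> \<psi> x = u))"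

definition extend_inverse :: "(real \<Rightarrow> real) \<Rightarrow> ennreal \<Rightarrow> real" where
  "extend_inverse \<psi> x = (if x = \<infinity> then 0 else \<psi> (enn2real x))"

definition archimedean_copula ::
    "nat \<Rightarrow> (real \<Rightarrow> ennreal) \<Rightarrow> ((nat \<Rightarrow> real) \<Rightarrow> real) \<Rightarrow> bool" where
  "archimedean_copula n \<phi> C \<longleftrightarrow>
    is_copula n C \<and>
    (\<exists>\<psi>. inverse_generator \<psi> \<and>
      (\<forall>v\<in>{0..1}. \<phi> v = generator_of \<psi> v) \<and>
      (\<forall>u \<in> {1..n} \<rightarrow> {0..1}. C u = extend_inverse \<psi> (\<Sum>i\<in>{1..n}. \<phi> (u i))))"

text \<open>
  Equality of conditional laws is expressed through the conditional probabilities of all Borel sets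
  \<open>B\<close>; since the Borel sets are countably generated, this is the same as almost sure equality
  of regular conditional distributions.
\<close>

definition markov_chain :: "'a measure \<Rightarrow> nat \<Rightarrow> (nat \<Rightarrow> 'a \<Rightarrow> real) \<Rightarrow> bool" where
  "markov_chain M n X \<longleftrightarrow>
    (\<forall>k. 1 \<le> k \<and> k < n \<longrightarrow> (\<forall>B \<in> sets borel. AE \<omega> in M.
      real_cond_exp M
        (vimage_algebra (space M) (\<lambda>\<omega>. \<lambda>i\<in>{1..k}. X i \<omega>) (Pi\<^sub>M {1..k} (\<lambda>_. borel)))
        (indicator (X (Suc k) -` B \<inter> space M)) \<omega> =
      real_cond_exp M
        (vimage_algebra (space M) (X k) borel)
        (indicator (X (Suc k) -` B \<inter> space M)) \<omega>))"

lemma is_copula_lipschitz: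
  assumes C: "is_copula n C" and i: "i \<in> {1..n}" and u: "u \<in> {1..n} \<rightarrow> {0..1}"
    and st: "0 \<le> s" "s \<le> t" "t \<le> 1"
  shows "\<bar>C (u(i := t)) - C (u(i := s))\<bar> \<le> t - s"
proof -
  obtain N where N: "prob_space N" "sets N = sets (Pi\<^sub>M {1..n} (\<lambda>_. borel :: real measure))"
    and marg: "\<And>i. i \<in> {1..n} \<Longrightarrow> distr N borel (\<lambda>x. x i) = uniform_measure lborel {0..1}"
    and CN: "\<And>u. u \<in> {1..n} \<rightarrow> {0..1} \<Longrightarrow> C u = joint_cdf N n (\<lambda>i x. x i) u"
    using C unfolding is_copula_def by blast
  interpret prob_space N by fact
  have coord[measurable]: "(\<lambda>x. x j) \<in> borel_measurable N" if "j \<in> {1..n}" for j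
    using that by (simp add: measurable_cong_sets[OF N(2) refl])
  define A where "A r = {x \<in> space N. \<forall>j\<in>{1..n}. x j \<le> (u(i := r)) j}" for r
  have A[measurable]: "A r \<in> sets N" for r
    unfolding A_def by (rule sets.sets_Collect_finite_All) (use coord in auto)
  have CA: "C (u(i := r)) = measure N (A r)" if "0 \<le> r" "r \<le> 1" for r
    using that u i by (subst CN) (auto simp: joint_cdf_def A_def Pi_iff)
  have sub: "A s \<subseteq> A t"
    using i st by (fastforce simp: A_def)
  have "C (u(i := t)) - C (u(i := s)) = measure N (A t - A s)"
    using st sub by (simp add: CA finite_measure_Diff)
  also have "\<dots> \<le> measure N ((\<lambda>x. x i) -` {s<..t} \<inter> space N)"
    by (rule finite_measure_mono)
       (use i in \<open>auto simp: A_def not_le split: if_splits intro!: measurable_sets[OF coord]\<close>)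
  also have "\<dots> = measure (distr N borel (\<lambda>x. x i)) {s<..t}"
    using i by (subst measure_distr) auto
  also have "\<dots> = measure lborel ({0..1} \<inter> {s<..t})"
    using i by (simp add: marg measure_uniform_measure)
  also have "{0..1} \<inter> {s<..t} = {s<..t}" using st by auto
  finally have "C (u(i := t)) - C (u(i := s)) \<le> t - s"
    using st by (simp del: fun_upd_apply)
  moreover have "C (u(i := s)) \<le> C (u(i := t))"
    using st sub by (simp add: CA finite_measure_mono)
  ultimately show ?thesis by simp
qed

lemma has_copula_unique:
  assumes M: "prob_space M" and X: "\<And>i. i \<in> {1..n} \<Longrightarrow> X i \<in> borel_measurable M"
    and C: "has_copula M n X C" and D: "has_copula M n X D"
    and u: "u \<in> {1..n} \<rightarrow> {0..1}"
  shows "C u = D u"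
proof -
  define R where "R i = range (marginal_cdf M (X i))" for i
  have "C u = D u" if "u \<in> {1..n} \<rightarrow> {0..1}" "\<And>i. i \<in> {1..n} \<Longrightarrow> m < i \<Longrightarrow> u i \<in> R i" "m \<le> n" for u m
    using that
  proof (induction m arbitrary: u)
    case 0
    then have "\<forall>i\<in>{1..n}. \<exists>x. u i = marginal_cdf M (X i) x"
      unfolding R_def by (fastforce simp: image_iff)
    then obtain x where x: "\<And>i. i \<in> {1..n} \<Longrightarrow> u i = marginal_cdf M (X i) (x i)" by metis
    have cong: "E u = E (\<lambda>i. marginal_cdf M (X i) (x i))" if "has_copula M n X E" for E
    proof -
      obtain N where CN: "\<And>u. u \<in> {1..n} \<rightarrow> {0..1} \<Longrightarrow> E u = joint_cdf N n (\<lambda>i x. x i) u"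
        using \<open>has_copula M n X E\<close> unfolding has_copula_def is_copula_def by blast
      have "(\<lambda>i. marginal_cdf M (X i) (x i)) \<in> {1..n} \<rightarrow> {0..1}"
        using 0(1) x by (auto simp: Pi_iff)
      then show ?thesis using 0(1) x by (simp add: CN joint_cdf_def)
    qed
    show ?case using cong[OF C] cong[OF D] C D unfolding has_copula_def by metis
  next
    case (Suc m)
    define i where "i = Suc m"
    have i: "i \<in> {1..n}" using Suc.prems by (auto simp: i_def)
    interpret P: prob_space M by fact
    interpret real_distribution "distr M borel (X i)"
      using X[OF i] by (rule P.real_distribution_distr)
    define g where "g r = C (u(i := r)) - D (u(i := r))" for r
    have upd: "u(i := r) \<in> {1..n} \<rightarrow> {0..1}" if "r \<in> {0..1}" for r
      using that Suc.prems(1) by auto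
    have R01: "R i \<subseteq> {0..1}"
      using cdf_nonneg cdf_bounded_prob by (auto simp: R_def)
    have g_R: "g r = 0" if "r \<in> R i" for r
    proof -
      have "C (u(i := r)) = D (u(i := r))"
      proof (rule Suc.IH)
        show "u(i := r) \<in> {1..n} \<rightarrow> {0..1}" using upd that R01 by blast
        show "(u(i := r)) j \<in> R j" if "j \<in> {1..n}" "m < j" for j
          using that \<open>r \<in> R i\<close> Suc.prems(2)[of j] by (cases "j = i") (auto simp: i_def)
      qed (use Suc.prems in auto)
      then show ?thesis by (simp add: g_def)
    qed
    have lip: "dist (E (u(i := t))) (E (u(i := s))) \<le> 1 * dist t s"
      if "is_copula n E" "s \<in> {0..1}" "t \<in> {0..1}" for E s t
      using is_copula_lipschitz[OF that(1) i Suc.prems(1), of s t]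
        is_copula_lipschitz[OF that(1) i Suc.prems(1), of t s] that
      by (cases "s \<le> t") (auto simp: dist_real_def)
    have cont_E: "continuous_on {0..1} (\<lambda>r. E (u(i := r)))" if "is_copula n E" for E
      by (rule lipschitz_on_continuous_on[of 1]) (use lip[OF that] in \<open>auto simp: lipschitz_on_def\<close>)
    have cont: "continuous_on {0..1} g"
      unfolding g_def using C D by (intro continuous_intros cont_E) (auto simp: has_copula_def)
    have clR: "closure (R i) \<subseteq> {0..1}" using R01 by (simp add: closure_minimal)
    have g_cl: "g r = 0" if "r \<in> closure (R i)" for r
      using continuous_constant_on_closure[OF continuous_on_subset[OF cont clR] g_R that] .
    have in0: "0 \<in> closure (R i)"
      by (rule Lim_in_closed_set[OF closed_closure _ _ cdf_lim_at_bot])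
         (auto simp: R_def intro!: always_eventually subsetD[OF closure_subset])
    have in1: "1 \<in> closure (R i)"
      by (rule Lim_in_closed_set[OF closed_closure _ _ cdf_lim_at_top_prob])
         (auto simp: R_def intro!: always_eventually subsetD[OF closure_subset])
    have "g r = 0" if r: "r \<in> {0..1}" "r \<notin> closure (R i)" for r
    proof -
      define a where "a = Sup (closure (R i) \<inter> {0..r})"
      define b where "b = Inf (closure (R i) \<inter> {r..1})"
      have a: "a \<in> closure (R i) \<inter> {0..r}" unfolding a_def
        by (rule closed_contains_Sup) (use in0 r in \<open>auto intro!: bdd_above.I2 closed_Int\<close>)
      have b: "b \<in> closure (R i) \<inter> {r..1}" unfolding b_def
        by (rule closed_contains_Inf) (use in1 r in \<open>auto intro!: closed_Int\<close>)
      have ar: "a < r" "r < b" using a b r by (force simp: less_le)+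
      have gap: "{a<..<b} \<inter> R i = {}"
      proof safe
        fix y assume y: "y \<in> {a<..<b}" "y \<in> R i"
        have yc: "y \<in> closure (R i)" "y \<in> {0..1}"
          using subsetD[OF closure_subset y(2)] subsetD[OF R01 y(2)] by simp_all
        have "y \<le> a" if "y \<le> r"
          unfolding a_def using yc that by (intro cSup_upper) auto
        moreover have "b \<le> y" if "r \<le> y"
          unfolding b_def using yc that by (intro cInf_lower) auto
        ultimately show "y \<in> {}" using y by force
      qed
      define t where "t = (r - a) / (b - a)"
      have "t * (b - a) = r - a" using ar by (simp add: t_def)
      then have "r = (1 - t) * a + t * b" by (simp add: algebra_simps)
      moreover have "t \<in> {0..1}" using ar by (simp add: t_def)
      ultimately have t: "t \<in> {0..1}" "r = (1 - t) * a + t * b" by blast+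
      have aff: "E (u(i := r)) = (1 - t) * E (u(i := a)) + t * E (u(i := b))"
        if "has_copula M n X E" for E
        using that i Suc.prems(1) a b ar gap t unfolding has_copula_def R_def by auto
      have "g r = (1 - t) * g a + t * g b"
        unfolding g_def aff[OF C] aff[OF D] by (simp add: algebra_simps)
      then show ?thesis using g_cl a b by simp
    qed
    then have "g (u i) = 0" using g_cl Suc.prems(1) i by blast
    then show ?case by (simp add: g_def)
  qed
  from this[of u n] u show ?thesis by simp
qed

end

theory Submission
  imports Defs
begin

text \<open>
  Write \<open>\<phi>\<close> for the generator, \<open>\<psi>\<close> for its inverse, and \<open>\<gamma> = - \<psi>'\<close>; nonnegativity of the volumes of
  three-dimensional boxes makes \<open>\<gamma>\<close> exist and be convex, hence continuous, on \<open>(0, \<infinity>)\<close>. If \<open>X 1\<close> and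
  \<open>X 3\<close> are conditionally independent given \<open>X 2\<close>, then
  \<open>\<partial>\<^sub>2 C(u, v, w) = \<partial>\<^sub>2 C(u, v, 1) \<cdot> \<partial>\<^sub>2 C(1, v, w)\<close> for almost all \<open>v\<close>. In terms of
  \<open>x = \<phi>(u)\<close>, \<open>y = \<phi>(v)\<close> and \<open>z = \<phi>(w)\<close> this is \<open>\<gamma>(x + y + z) \<gamma>(y) = \<gamma>(x + y) \<gamma>(y + z)\<close>, and it
  forces \<open>\<psi>(x) = exp(- r x)\<close>, that is, the product copula.

  Marginals may have atoms. On the \<open>X 2\<close> side the integrals over the law of \<open>X 2\<close> are pulled back to
  \<open>(0, 1)\<close> along its quantile function, which is constant on the gaps of the range of the marginal
  distribution function, as is the derivative of the interpolated copula. For \<open>u\<close> and \<open>w\<close> the equation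
  first holds on the ranges of the marginal distribution functions. It extends to \<open>[0, 1]\<close> because both
  sides are left-continuous and affine on the gaps.
\<close>

section \<open>Three-monotone generators\<close>

text \<open>Subtracting the chord over \<open>[p, q]\<close> gives \<open>h\<close>, which vanishes
  at both ends. At a maximum point \<open>m\<close> of \<open>h\<close>, the midpoint inequality
  with a step reaching the nearer end yields \<open>2 * h m \<le> 0 + h m\<close>, so
  \<open>h\<close> is nowhere positive on \<open>[p, q]\<close>.\<close>

lemma convex_on_if_increments_mono:
  fixes f :: "real \<Rightarrow> real"
  assumes cont: "continuous_on {0..} f"
    and incr: "\<And>a b k. 0 \<le> a \<Longrightarrow> a \<le> b \<Longrightarrow> 0 \<le> k \<Longrightarrow> f (a + k) - f a \<le> f (b + k) - f b"
  shows "convex_on {0..} f"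
proof (rule convex_on_linorderI)
  fix t p q :: real assume t: "0 < t" "t < 1" and pq: "p \<in> {0..}" "q \<in> {0..}" "p < q"
  define s where "s = (f q - f p) / (q - p)"
  define h where "h x = f x - f p - (x - p) * s" for x
  have hpq: "h p = 0" "h q = 0" using pq by (auto simp: h_def s_def)
  have "continuous_on {p..q} h" unfolding h_def
    by (intro continuous_intros continuous_on_subset[OF cont]) (use pq in auto)
  then obtain m where m: "m \<in> {p..q}" "\<And>x. x \<in> {p..q} \<Longrightarrow> h x \<le> h m"
    using continuous_attains_sup[of "{p..q}" h] pq by fastforce
  have mid: "2 * h m \<le> h (m - k) + h (m + k)" if "0 \<le> k" "k \<le> m" for k
  proof -
    have "f m - f (m - k) \<le> f (m + k) - f m"
      using incr[of "m - k" m k] that by simp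
    then show ?thesis by (simp add: h_def algebra_simps)
  qed
  have "h m \<le> 0"
  proof (cases "m - p \<le> q - m")
    case True
    then show ?thesis using mid[of "m - p"] m(1) m(2)[of "m + (m - p)"] hpq pq by auto
  next
    case False
    then show ?thesis using mid[of "q - m"] m(1) m(2)[of "m - (q - m)"] hpq pq by auto
  qed
  moreover have mem: "(1 - t) * p + t * q \<in> {p..q}"
  proof -
    have "(1 - t) * p + t * q = p + t * (q - p)" "(1 - t) * p + t * q = q - (1 - t) * (q - p)"
      by (simp_all add: algebra_simps)
    moreover have "0 \<le> t * (q - p)" "0 \<le> (1 - t) * (q - p)" using t pq by simp_all
    ultimately show ?thesis unfolding atLeastAtMost_iff by linarith
  qed
  ultimately have "h ((1 - t) * p + t * q) \<le> 0" using m(2) by (meson order_trans)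
  moreover have "((1 - t) * p + t * q - p) * s = t * (f q - f p)"
  proof -
    have "(1 - t) * p + t * q - p = t * (q - p)" by (simp add: algebra_simps)
    then show ?thesis using pq by (simp add: s_def)
  qed
  ultimately show "f ((1 - t) *\<^sub>R p + t *\<^sub>R q) \<le> (1 - t) * f p + t * f q"
    by (simp add: h_def algebra_simps)
qed simp

section \<open>Elementary properties of an inverse generator\<close>

locale inverse_generator_function =
  fixes \<psi> :: "real \<Rightarrow> real"
  assumes gen: "inverse_generator \<psi>"
begin

lemma antimono: "0 \<le> x \<Longrightarrow> x \<le> y \<Longrightarrow> \<psi> y \<le> \<psi> x"
  using gen by (auto simp: inverse_generator_def monotone_on_def)

lemma cont: "continuous_on {0..} \<psi>"
  using gen by (simp add: inverse_generator_def)

lemma psi_0 [simp]: "\<psi> 0 = 1"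
  using gen by (simp add: inverse_generator_def)

lemma lim: "(\<psi> \<longlongrightarrow> 0) at_top"
  using gen by (simp add: inverse_generator_def)

lemma psi_nonneg: assumes "0 \<le> x" shows "0 \<le> \<psi> x"
proof (rule tendsto_upperbound[OF lim])
  show "\<forall>\<^sub>F y in at_top. \<psi> y \<le> \<psi> x"
    using eventually_ge_at_top[of x] by eventually_elim (use assms in \<open>auto intro: antimono\<close>)
qed simp

lemma psi_le_1: "0 \<le> x \<Longrightarrow> \<psi> x \<le> 1"
  using antimono[of 0 x] by simp

text \<open>The generator condition compares only points where \<psi> is positive. If
  \<open>\<psi> y\<close> is not positive it is 0, hence below \<open>\<psi> x\<close>.\<close>

lemma strict: "0 \<le> x \<Longrightarrow> x < y \<Longrightarrow> \<psi> x > 0 \<Longrightarrow> \<psi> y < \<psi> x"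
  using gen psi_nonneg[of y] unfolding inverse_generator_def monotone_on_def
  by (cases "\<psi> y > 0") auto

lemma inj: "0 \<le> x \<Longrightarrow> 0 \<le> y \<Longrightarrow> \<psi> x > 0 \<Longrightarrow> \<psi> x = \<psi> y \<Longrightarrow> x = y"
  using strict[of x y] strict[of y x] by (cases x y rule: linorder_cases) auto

text \<open>A real-valued stand-in for \<open>generator_of \<psi>\<close>, meaningful for
  \<open>0 < u \<le> 1\<close> only. At 0 the described point does not exist or is not unique, so
  vanishing coordinates are treated separately throughout.\<close>

definition \<phi> :: "real \<Rightarrow> real" where
  "\<phi> u = (THE x. 0 \<le> x \<and> \<psi> x = u)"

lemma \<phi>_psi [simp]: assumes "0 \<le> x" "0 < \<psi> x" shows "\<phi> (\<psi> x) = x"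
  unfolding \<phi>_def using assms by (intro the_equality) (auto intro: inj[symmetric])

lemma obtain_psi:
  assumes "0 < u" "u \<le> 1" obtains x where "0 \<le> x" "\<psi> x = u"
proof -
  have "\<forall>\<^sub>F x in at_top. \<psi> x < u" using lim assms(1) by (rule order_tendstoD)
  then obtain b where b: "0 \<le> b" "\<psi> b < u"
    by (metis (mono_tags, lifting) eventually_at_top_linorder linear order_refl)
  have "\<exists>x\<ge>0. x \<le> b \<and> \<psi> x = u"
    by (rule IVT2') (use b assms in \<open>auto intro: continuous_on_subset[OF cont]\<close>)
  then show ?thesis using that by blast
qed

lemma \<phi>_nonneg: "0 < u \<Longrightarrow> u \<le> 1 \<Longrightarrow> 0 \<le> \<phi> u"
  using obtain_psi[of u] by (metis \<phi>_psi)

lemma psi_\<phi> [simp]: "0 < u \<Longrightarrow> u \<le> 1 \<Longrightarrow> \<psi> (\<phi> u) = u"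
  using obtain_psi[of u] by (metis \<phi>_psi)

lemma \<phi>_1 [simp]: "\<phi> 1 = 0"
  using \<phi>_psi[of 0] by simp

lemma \<phi>_pos: "0 < u \<Longrightarrow> u < 1 \<Longrightarrow> 0 < \<phi> u"
  using \<phi>_nonneg[of u] psi_\<phi>[of u] by (cases "\<phi> u = 0") auto

end

text \<open>The condition is nonnegativity of box volumes read in the coordinates
  \<open>x = \<phi> u\<close>; as \<psi> is decreasing, the sign of a third difference is reversed.
  It replaces any smoothness assumption on \<psi>.\<close>

locale three_monotone_inverse_generator = inverse_generator_function +
  assumes third_difference:
      "\<And>a h k l. 0 \<le> a \<Longrightarrow> 0 \<le> h \<Longrightarrow> 0 \<le> k \<Longrightarrow> 0 \<le> l \<Longrightarrow>
        \<psi> (a + h + k + l) - \<psi> (a + h + k) - \<psi> (a + h + l) - \<psi> (a + k + l)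
          + \<psi> (a + h) + \<psi> (a + k) + \<psi> (a + l) - \<psi> a \<le> 0"
begin

text \<open>The increments over \<open>k\<close> of this function at \<open>b\<close> and at
  \<open>a\<close> differ by minus the third difference with steps \<open>h\<close>,
  \<open>k\<close> and \<open>b - a\<close>. Division by \<open>h\<close> and a supremum will
  transfer the convexity to \<gamma>.\<close>

lemma convex_increment:
  assumes "0 \<le> h" shows "convex_on {0..} (\<lambda>y. \<psi> y - \<psi> (y + h))"
proof (rule convex_on_if_increments_mono)
  show "continuous_on {0..} (\<lambda>y. \<psi> y - \<psi> (y + h))"
    by (intro continuous_intros continuous_on_compose2[OF cont]) (use assms in auto)
  fix a b k :: real assume "0 \<le> a" "a \<le> b" "0 \<le> k"
  then show "\<psi> (a + k) - \<psi> (a + k + h) - (\<psi> a - \<psi> (a + h))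
      \<le> \<psi> (b + k) - \<psi> (b + k + h) - (\<psi> b - \<psi> (b + h))"
    using third_difference[of a h k "b - a"] assms by (simp add: algebra_simps)
qed

text \<open>As \<open>h\<close> tends to infinity, every term shifted by \<open>h\<close> vanishes
  and the third-difference inequality degenerates to the second-difference one.\<close>

lemma convex: "convex_on {0..} \<psi>"
proof (rule convex_on_if_increments_mono[OF cont])
  fix a b k :: real assume *: "0 \<le> a" "a \<le> b" "0 \<le> k"
  have shift: "((\<lambda>h. \<psi> (x + h)) \<longlongrightarrow> 0) at_top" for x
    by (rule filterlim_compose[OF lim])
       (rule filterlim_tendsto_add_at_top[OF tendsto_const filterlim_ident])
  have "((\<lambda>h. (\<psi> (b + k) - \<psi> (b + k + h)) - (\<psi> b - \<psi> (b + h))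
      - ((\<psi> (a + k) - \<psi> (a + k + h)) - (\<psi> a - \<psi> (a + h))))
    \<longlongrightarrow> (\<psi> (b + k) - 0) - (\<psi> b - 0) - ((\<psi> (a + k) - 0) - (\<psi> a - 0))) at_top"
    by (intro tendsto_intros shift)
  moreover have "\<forall>\<^sub>F h in at_top. 0 \<le> (\<psi> (b + k) - \<psi> (b + k + h)) - (\<psi> b - \<psi> (b + h))
      - ((\<psi> (a + k) - \<psi> (a + k + h)) - (\<psi> a - \<psi> (a + h)))"
    using eventually_ge_at_top[of 0]
  proof eventually_elim
    case (elim h)
    then show ?case using third_difference[of a h k "b - a"] * by (simp add: algebra_simps)
  qed
  ultimately have "0 \<le> (\<psi> (b + k) - 0) - (\<psi> b - 0) - ((\<psi> (a + k) - 0) - (\<psi> a - 0))"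
    by (rule tendsto_lowerbound) simp
  then show "\<psi> (a + k) - \<psi> a \<le> \<psi> (b + k) - \<psi> b" by simp
qed

lemma slope_antimono:
  assumes "0 \<le> a" "a < b" "b < c"
  shows "(\<psi> b - \<psi> c) / (c - b) \<le> (\<psi> a - \<psi> b) / (b - a)"
proof -
  have "(\<psi> a - \<psi> b) / (a - b) \<le> (\<psi> b - \<psi> c) / (b - c)"
    using convex_on_slope_le[OF convex, of a c b] assms by simp
  moreover have "(\<psi> a - \<psi> b) / (a - b) = - ((\<psi> a - \<psi> b) / (b - a))"
    "(\<psi> b - \<psi> c) / (b - c) = - ((\<psi> b - \<psi> c) / (c - b))"
    using assms by (simp_all add: field_simps)
  ultimately show ?thesis by simp
qed

text \<open>By convexity of \<psi> the quotients decrease in \<open>h\<close>, so on the positive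
  half-line this is minus the right derivative. The supremum form gives convexity of \<gamma> before
  differentiability of \<psi> is known.\<close>

definition \<gamma> :: "real \<Rightarrow> real" where
  "\<gamma> y = (SUP h\<in>{0<..}. (\<psi> y - \<psi> (y + h)) / h)"

lemma \<gamma>_least: "(\<And>h. 0 < h \<Longrightarrow> (\<psi> y - \<psi> (y + h)) / h \<le> c) \<Longrightarrow> \<gamma> y \<le> c"
  unfolding \<gamma>_def by (rule cSUP_least) auto

lemma \<gamma>_lower:
  assumes "0 < a" "a < b" shows "\<gamma> b \<le> (\<psi> a - \<psi> b) / (b - a)"
  by (rule \<gamma>_least) (use slope_antimono[of a b "b + h" for h] assms in force)

lemma \<gamma>_ge:
  assumes "0 < a" "0 < h" shows "(\<psi> a - \<psi> (a + h)) / h \<le> \<gamma> a"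
  unfolding \<gamma>_def
proof (rule cSUP_upper)
  \<comment> \<open>Convexity bounds every slope to the right of \<open>a\<close> by the slope over
    \<open>[a/2, a]\<close>.\<close>
  show "bdd_above ((\<lambda>h. (\<psi> a - \<psi> (a + h)) / h) ` {0<..})"
    by (rule bdd_aboveI[of _ "(\<psi> (a/2) - \<psi> a) / (a/2)"])
       (use slope_antimono[of "a/2" a "a + h" for h] assms in force)
qed (use assms in auto)

lemma \<gamma>_upper: "0 < a \<Longrightarrow> a < b \<Longrightarrow> (\<psi> a - \<psi> b) / (b - a) \<le> \<gamma> a"
  using \<gamma>_ge[of a "b - a"] by simp

lemma \<gamma>_nonneg: assumes "0 < y" shows "0 \<le> \<gamma> y"
proof -
  have "0 \<le> (\<psi> y - \<psi> (y + 1)) / 1" using assms by (simp add: antimono)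
  also have "\<dots> \<le> \<gamma> y" by (rule \<gamma>_ge) (use assms in auto)
  finally show ?thesis .
qed

lemma \<gamma>_pos: assumes "0 < y" "0 < \<psi> y" shows "0 < \<gamma> y"
proof -
  have "0 < (\<psi> y - \<psi> (y + 1)) / 1" using assms strict[of y "y + 1"] by simp
  also have "\<dots> \<le> \<gamma> y" by (rule \<gamma>_ge) (use assms in auto)
  finally show ?thesis .
qed

lemma \<gamma>_eq_0: assumes "0 < y" "\<psi> y = 0" shows "\<gamma> y = 0"
proof -
  have "\<psi> (y + h) = 0" if "0 < h" for h
    using antimono[of y "y + h"] psi_nonneg[of "y + h"] assms that by simp
  then have "\<gamma> y \<le> 0" using assms by (intro \<gamma>_least) simp
  then show ?thesis using \<gamma>_nonneg[of y] assms by simp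
qed

text \<open>A supremum over \<open>h\<close> of the convex functions from
  \<open>convex_increment\<close>, each divided by \<open>h\<close>.\<close>

lemma \<gamma>_convex: "convex_on {0<..} \<gamma>"
proof (rule convex_on_linorderI)
  fix t x y :: real assume t: "0 < t" "t < 1" and xy: "x \<in> {0<..}" "y \<in> {0<..}" "x < y"
  show "\<gamma> ((1 - t) *\<^sub>R x + t *\<^sub>R y) \<le> (1 - t) * \<gamma> x + t * \<gamma> y"
  proof (rule \<gamma>_least)
    fix h :: real assume h: "0 < h"
    define D where "D y = \<psi> y - \<psi> (y + h)" for y
    have "D ((1 - t) *\<^sub>R x + t *\<^sub>R y) \<le> (1 - t) * D x + t * D y"
      using convex_onD[OF convex_increment, of h t x y] t xy h by (simp add: D_def)
    then have "D ((1 - t) *\<^sub>R x + t *\<^sub>R y) / h \<le> ((1 - t) * D x + t * D y) / h"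
      using h by (simp add: divide_right_mono)
    also have "\<dots> = (1 - t) * (D x / h) + t * (D y / h)"
      by (simp add: add_divide_distrib)
    also have "\<dots> \<le> (1 - t) * \<gamma> x + t * \<gamma> y"
      unfolding D_def using t xy h by (intro add_mono mult_left_mono \<gamma>_ge) auto
    finally show "(\<psi> ((1 - t) *\<^sub>R x + t *\<^sub>R y) - \<psi> ((1 - t) *\<^sub>R x + t *\<^sub>R y + h)) / h \<le> \<dots>"
      by (simp add: D_def)
  qed
qed simp

lemma \<gamma>_isCont: "0 < y \<Longrightarrow> isCont \<gamma> y"
  using convex_on_continuous[OF _ \<gamma>_convex] by (simp add: continuous_on_eq_continuous_at)

text \<open>By \<open>\<gamma>_lower\<close> and \<open>\<gamma>_upper\<close>, minus the slope of
  \<psi> between \<open>y\<close> and \<open>z\<close> lies between \<open>\<gamma> y\<close> and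
  \<open>\<gamma> z\<close>. Being convex on an open half-line, \<gamma> is continuous, so the slope
  converges.\<close>

lemma psi_deriv: assumes y: "0 < y" shows "(\<psi> has_real_derivative - \<gamma> y) (at y)"
  unfolding has_field_derivative_iff
proof (rule LIM_zero_cancel)
  have ev: "\<forall>\<^sub>F z in at y. norm ((\<psi> z - \<psi> y) / (z - y) - - \<gamma> y) \<le> norm (\<gamma> z - \<gamma> y)"
  proof -
    have "\<forall>\<^sub>F z in at y. z \<in> {0<..}"
      by (rule eventually_at_in_open') (use y in auto)
    moreover have "\<forall>\<^sub>F z in at y. z \<noteq> y" by (simp add: eventually_at_filter)
    ultimately show ?thesis
    proof eventually_elim
      case (elim z)
      have "(\<psi> z - \<psi> y) / (z - y) = - ((\<psi> z - \<psi> y) / (y - z))"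
        "(\<psi> z - \<psi> y) / (z - y) = - ((\<psi> y - \<psi> z) / (z - y))"
        using elim by (auto simp: field_simps)
      then show ?case using elim y \<gamma>_lower[of z y] \<gamma>_lower[of y z] \<gamma>_upper[of z y] \<gamma>_upper[of y z]
        by (cases z y rule: linorder_cases) auto
    qed
  qed
  have "((\<lambda>z. \<gamma> z - \<gamma> y) \<longlongrightarrow> \<gamma> y - \<gamma> y) (at y)"
    using \<gamma>_isCont[OF y] by (intro tendsto_intros) (simp add: isCont_def)
  then have "((\<lambda>z. \<gamma> z - \<gamma> y) \<longlongrightarrow> 0) (at y)" by simp
  then show "((\<lambda>z. (\<psi> z - \<psi> y) / (z - y) - - \<gamma> y) \<longlongrightarrow> 0) (at y)"
    by (rule Lim_null_comparison[OF ev tendsto_norm_zero])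
qed

text \<open>Integrating the functional equation in \<open>z\<close> turns it into \<open>\<gamma> (x + y) \<psi> y = \<gamma> y \<psi> (x + y)\<close>, that is,
  \<open>\<psi>' / \<psi>\<close> is constant.\<close>

lemma exponential_if_functional_equation:
  assumes eq: "\<And>x y z. 0 < x \<Longrightarrow> 0 < y \<Longrightarrow> 0 < z \<Longrightarrow>
    \<gamma> (x + y + z) * \<gamma> y = \<gamma> (x + y) * \<gamma> (y + z)"
  obtains r where "\<And>x. 0 \<le> x \<Longrightarrow> \<psi> x = exp (- r * x)"
proof -
  have shift: "((\<lambda>h. \<psi> (x + h)) \<longlongrightarrow> 0) at_top" for x
    by (rule filterlim_compose[OF lim])
       (rule filterlim_tendsto_add_at_top[OF tendsto_const filterlim_ident])
  have ratio: "\<psi> b * \<gamma> a = \<gamma> b * \<psi> a" if "0 < a" "a < b" for a b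
  proof -
    \<comment> \<open>The derivative of \<open>G\<close> in \<open>z\<close> is the functional
      equation at \<open>b - a\<close>, \<open>a\<close>, \<open>z\<close>, hence 0. Since
      \<open>G\<close> also vanishes at infinity, it is identically 0 for
      \<open>0 < z\<close>.\<close>
    define G where "G z = \<psi> (b + z) * \<gamma> a - \<gamma> b * \<psi> (a + z)" for z
    have "(G has_real_derivative 0) (at z)" if "0 < z" for z
    proof -
      have "\<gamma> (b + z) * \<gamma> a = \<gamma> b * \<gamma> (a + z)"
        using eq[of "b - a" a z] \<open>0 < a\<close> \<open>a < b\<close> that by simp
      then show ?thesis unfolding G_def
        using that \<open>0 < a\<close> \<open>a < b\<close>
        by (auto intro!: derivative_eq_intros DERIV_chain2[OF psi_deriv])
    qed
    then have const: "G z = G 1" if "0 < z" for z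
      using has_field_derivative_zero_constant[of "{0<..}" G] that
      by (force intro: has_field_derivative_at_within)
    have "(G \<longlongrightarrow> 0 * \<gamma> a - \<gamma> b * 0) at_top"
      unfolding G_def by (intro tendsto_intros shift)
    moreover have "(G \<longlongrightarrow> G 1) at_top"
      by (rule tendsto_eventually, rule eventually_mono[OF eventually_gt_at_top[of 0]]) (rule const)
    ultimately have G1: "G 1 = 0" using tendsto_unique[of at_top G] by simp
    \<comment> \<open>The equation is available for \<open>0 < z\<close> only; the value at
      \<open>z = 0\<close> is reached as a right limit.\<close>
    have psi_shift: "isCont (\<lambda>z. \<psi> (u + z)) 0" if "0 < u" for u
      using isCont_o2[of 0 "\<lambda>z. u + z" \<psi>] DERIV_isCont[OF psi_deriv[OF that]] by simp
    have "isCont G 0"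
      unfolding G_def using that by (intro isCont_diff isCont_mult psi_shift) auto
    then have "(G \<longlongrightarrow> G 0) (at_right 0)"
      by (simp add: continuous_within isCont_def filterlim_at_split)
    moreover have "(G \<longlongrightarrow> G 1) (at_right 0)"
      by (rule tendsto_eventually, rule eventually_mono[OF eventually_at_right_less]) (rule const)
    ultimately have "G 0 = 0" using G1 tendsto_unique[of "at_right 0" G] by simp
    then show ?thesis by (simp add: G_def)
  qed
  \<comment> \<open>A reference point where \<psi> is positive, found near 0 because
    \<open>\<psi> 0 = 1\<close>. The quotient of \<gamma> and \<psi> there will be the rate.\<close>
  obtain c where c: "0 < c" "0 < \<psi> c"
  proof -
    have "(\<psi> \<longlongrightarrow> 1) (at_right 0)"
      using cont by (metis atLeast_iff continuous_on_Icc_at_rightD continuous_on_subset psi_0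
          Icc_subset_Ici_iff order_refl zero_less_one)
    then have "\<forall>\<^sub>F x in at_right 0. 0 < \<psi> x" by (rule order_tendstoD) simp
    then have "\<forall>\<^sub>F x in at_right 0. 0 < x \<and> 0 < \<psi> x"
      using eventually_at_right_less by eventually_elim auto
    then show ?thesis using that eventually_happens'[OF trivial_limit_at_right_real] by blast
  qed
  define r where "r = \<gamma> c / \<psi> c"
  have \<gamma>: "\<gamma> y = r * \<psi> y" if "0 < y" for y
    using ratio[of y c] ratio[of c y] that c
    by (cases y c rule: linorder_cases) (auto simp: r_def field_simps)
  \<comment> \<open>\<open>\<gamma> = r \<psi>\<close> makes this function constant on the positive
    half-line; continuity at 0, where it equals 1, fixes the constant.\<close>
  define E where "E y = \<psi> y * exp (r * y)" for y
  have "(E has_real_derivative 0) (at y)" if "0 < y" for y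
    unfolding E_def using that
    by (auto intro!: derivative_eq_intros psi_deriv simp: \<gamma>)
  then have const: "E y = E 1" if "0 < y" for y
    using has_field_derivative_zero_constant[of "{0<..}" E] that
    by (force intro: has_field_derivative_at_within)
  have "continuous_on {0..} E" unfolding E_def by (intro continuous_intros cont)
  then have "(E \<longlongrightarrow> E 0) (at_right 0)"
    by (metis continuous_on_Icc_at_rightD continuous_on_subset
        Icc_subset_Ici_iff order_refl zero_less_one)
  moreover have "(E \<longlongrightarrow> E 1) (at_right 0)"
    by (rule tendsto_eventually, rule eventually_mono[OF eventually_at_right_less]) (rule const)
  ultimately have "E 0 = E 1" using tendsto_unique[of "at_right 0" E] by simp
  then have E_1: "E y = 1" if "0 \<le> y" for y
    using const[of y] that by (cases "y = 0") (auto simp: E_def)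
  have "\<psi> y = exp (- r * y)" if "0 \<le> y" for y
    using E_1[OF that] by (simp add: E_def exp_minus inverse_eq_divide eq_divide_eq)
  then show ?thesis by (rule that)
qed

end

section \<open>The functional equation from conditional densities\<close>

text \<open>Both functions, restricted to \<open>{a<..b}\<close>, are densities of finite measures
  with the same distribution function. These measures coincide, and densities are unique almost
  everywhere.\<close>

lemma AE_eq_if_interval_integrals_eq:
  fixes f g :: "real \<Rightarrow> real"
  assumes f: "set_integrable lborel {a<..b} f" "\<And>v. v \<in> {a<..b} \<Longrightarrow> 0 \<le> f v"
    and g: "set_integrable lborel {a<..b} g" "\<And>v. v \<in> {a<..b} \<Longrightarrow> 0 \<le> g v"
    and eq: "\<And>v. v \<in> {a<..b} \<Longrightarrow> (LINT t:{a<..v}|lborel. f t) = (LINT t:{a<..v}|lborel. g t)"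
  shows "AE v in lborel. v \<in> {a<..b} \<longrightarrow> f v = g v"
proof (cases "a < b")
  case True
  define I where "I h v = indicator {a<..b} v * h v" for h :: "real \<Rightarrow> real" and v
  define D where "D h = density lborel (\<lambda>v. ennreal (I h v))" for h
  have D: "finite_borel_measure (D h)"
    "cdf (D h) t = (if t \<le> a then 0 else LINT v:{a<..min t b}|lborel. h v)"
    if h: "set_integrable lborel {a<..b} h" "\<And>v. v \<in> {a<..b} \<Longrightarrow> 0 \<le> h v" for h t
  proof -
    have int: "integrable lborel (I h)" using h(1) by (simp add: I_def[abs_def] set_integrable_def)
    then have [measurable]: "I h \<in> borel_measurable borel" by simp
    have nonneg: "0 \<le> I h v" for v using h(2) by (simp add: I_def indicator_def)
    have em: "emeasure (D h) A = ennreal (\<integral>v. indicator A v * I h v \<partial>lborel)" if A: "A \<in> sets borel" for A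
    proof -
      have "emeasure (D h) A = (\<integral>\<^sup>+v. ennreal (indicator A v * I h v) \<partial>lborel)"
        unfolding D_def using A by (subst emeasure_density) (auto simp: indicator_def intro!: nn_integral_cong)
      also have "\<dots> = ennreal (\<integral>v. indicator A v * I h v \<partial>lborel)"
        using integrable_mult_indicator[of A lborel "I h"] A int nonneg
        by (intro nn_integral_eq_integral) auto
      finally show ?thesis .
    qed
    show "finite_borel_measure (D h)"
      unfolding finite_borel_measure_def finite_borel_measure_axioms_def
      using em[of UNIV] by (auto simp: D_def intro!: finite_measureI)
    have "cdf (D h) t = (\<integral>v. indicator {..t} v * I h v \<partial>lborel)"
      unfolding cdf_def measure_def by (subst em) (auto intro!: enn2real_ennreal Bochner_Integration.integral_nonneg mult_nonneg_nonneg nonneg)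
    also have "\<dots> = (\<integral>v. indicator {a<..min t b} v *\<^sub>R h v \<partial>lborel)"
      by (rule Bochner_Integration.integral_cong) (auto simp: I_def indicator_def)
    finally show "cdf (D h) t = (if t \<le> a then 0 else LINT v:{a<..min t b}|lborel. h v)"
      by (auto simp: set_lebesgue_integral_def min_def)
  qed
  have "cdf (D f) t = cdf (D g) t" for t
  proof -
    have "cdf (D f) t = (if t \<le> a then 0 else LINT v:{a<..min t b}|lborel. f v)"
      by (rule D(2)) (use f in auto)
    moreover have "cdf (D g) t = (if t \<le> a then 0 else LINT v:{a<..min t b}|lborel. g v)"
      by (rule D(2)) (use g in auto)
    ultimately show ?thesis using eq[of "min t b"] True by simp
  qed
  moreover have "finite_borel_measure (D f)" by (rule D(1)) (use f in auto)
  moreover have "finite_borel_measure (D g)" by (rule D(1)) (use g in auto)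
  ultimately have "D f = D g" by (intro cdf_unique') auto
  moreover have "I f \<in> borel_measurable lborel" "I g \<in> borel_measurable lborel"
    using f(1) g(1) by (auto simp: I_def[abs_def] set_integrable_def dest: borel_measurable_integrable)
  ultimately have "AE v in lborel. ennreal (I f v) = ennreal (I g v)"
    unfolding D_def by (intro sigma_finite_measure.density_unique[OF sigma_finite_lborel]) auto
  then show ?thesis
    by eventually_elim (use f g in \<open>auto simp: I_def\<close>)
qed auto

section \<open>Differentiation in the middle coordinate\<close>

context three_monotone_inverse_generator
begin

lemma psi_isCont: "0 < x \<Longrightarrow> isCont \<psi> x"
  by (rule DERIV_isCont[OF psi_deriv])

lemma \<phi>_isCont: assumes u: "0 < u" "u < 1" shows "isCont \<phi> u"
proof -
  define x where "x = \<phi> u"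
  have x: "0 < x" "\<psi> x = u" using u by (auto simp: x_def \<phi>_pos)
  have "\<forall>\<^sub>F z in nhds x. 0 < \<psi> z"
    using order_tendstoD(1)[OF psi_isCont[OF x(1), unfolded isCont_def tendsto_at_iff_tendsto_nhds]] x u
    by simp
  moreover have "\<forall>\<^sub>F z in nhds x. 0 < z"
    using eventually_nhds_in_open[of "{0<..}" x] x by simp
  ultimately have "\<forall>\<^sub>F z in nhds x. 0 < z \<and> 0 < \<psi> z" by eventually_elim simp
  then obtain d where d: "0 < d" "\<And>z. dist z x < d \<Longrightarrow> 0 < z \<and> 0 < \<psi> z"
    unfolding eventually_nhds_metric by blast
  \<comment> \<open>The inverse function rule works on a closed ball, hence half of the radius
    \<open>d\<close>.\<close>
  have "isCont \<phi> (\<psi> x)"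
    by (rule isCont_inverse_function[where d = "d / 2"])
       (use d in \<open>force simp: dist_real_def intro!: psi_isCont \<phi>_psi less_imp_le\<close>)+
  then show ?thesis using x by simp
qed

text \<open>The derivative of \<open>v \<mapsto> \<psi> (x + \<phi> v)\<close>.\<close>

definition dens :: "real \<Rightarrow> real \<Rightarrow> real" where
  "dens x v = \<gamma> (x + \<phi> v) / \<gamma> (\<phi> v)"

lemma dens_nonneg: "0 \<le> x \<Longrightarrow> 0 < v \<Longrightarrow> v < 1 \<Longrightarrow> 0 \<le> dens x v"
  unfolding dens_def using \<phi>_pos[of v] by (simp add: \<gamma>_nonneg)

lemma \<gamma>_\<phi>_pos: "0 < v \<Longrightarrow> v < 1 \<Longrightarrow> 0 < \<gamma> (\<phi> v)"
  by (rule \<gamma>_pos) (simp_all add: \<phi>_pos)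

lemma \<gamma>_shift_isCont: 
  assumes "0 \<le> x" "0 < v" "v < 1" shows "isCont (\<lambda>v. \<gamma> (x + \<phi> v)) v"
  by (rule isCont_o2[where g = \<gamma>]) (use assms \<phi>_pos[of v] in \<open>auto intro!: \<gamma>_isCont isCont_add \<phi>_isCont\<close>)

lemma dens_isCont: "0 \<le> x \<Longrightarrow> 0 < v \<Longrightarrow> v < 1 \<Longrightarrow> isCont (dens x) v"
  unfolding dens_def [abs_def] using \<gamma>_shift_isCont[of x v] \<gamma>_shift_isCont[of 0 v] \<gamma>_\<phi>_pos[of v]
  by (intro isCont_divide) simp_all

lemma psi_shift_deriv:
  assumes "0 \<le> x" "0 < v" "v < 1"
  shows "((\<lambda>v. \<psi> (x + \<phi> v)) has_real_derivative dens x v) (at v)"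
proof -
  have "(\<phi> has_real_derivative inverse (- \<gamma> (\<phi> v))) (at v)"
    by (rule DERIV_inverse_function[where f = \<psi> and a = 0 and b = 1])
       (use assms \<gamma>_\<phi>_pos[of v] in \<open>auto intro!: psi_deriv \<phi>_pos \<phi>_isCont\<close>)
  then have *: "((\<lambda>v. x + \<phi> v) has_real_derivative inverse (- \<gamma> (\<phi> v))) (at v)"
    by (auto intro!: derivative_eq_intros)
  have "(\<psi> has_real_derivative - \<gamma> (x + \<phi> v)) (at (x + \<phi> v))"
    using \<phi>_pos[of v] assms by (intro psi_deriv) simp
  from DERIV_chain2[OF this *] show ?thesis
    by (simp add: dens_def divide_inverse)
qed

text \<open>The fundamental theorem of calculus for a nonnegative, possibly improper integrand. At 0
  the antiderivative is squeezed, because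
  \<open>\<psi> (x + \<phi> t) \<le> \<psi> (\<phi> t) = t\<close>; the right endpoint adds a null
  set.\<close>

lemma dens_integral:
  assumes x: "0 \<le> x" and v: "0 < v" "v < 1"
  shows "set_integrable lborel {0<..v} (dens x)"
    "(LINT t:{0<..v}|lborel. dens x t) = \<psi> (x + \<phi> v)"
proof -
  have lim0: "((\<lambda>v. \<psi> (x + \<phi> v)) \<longlongrightarrow> 0) (at_right 0)"
  proof (rule tendsto_sandwich[where f = "\<lambda>_. 0" and h = "\<lambda>v. v"])
    have ev: "\<forall>\<^sub>F t::real in at_right 0. t \<in> {0<..<1}"
      by (rule eventually_at_right_real) simp
    show "\<forall>\<^sub>F t in at_right 0. 0 \<le> \<psi> (x + \<phi> t)"
      using ev by eventually_elim (use x in \<open>auto intro!: psi_nonneg add_nonneg_nonneg \<phi>_nonneg\<close>)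
    show "\<forall>\<^sub>F t in at_right 0. \<psi> (x + \<phi> t) \<le> t"
      using ev
    proof eventually_elim
      case (elim t)
      then show ?case using antimono[of "\<phi> t" "x + \<phi> t"] x by (simp add: \<phi>_nonneg)
    qed
  qed (auto intro: tendsto_ident_at)
  have "((\<lambda>v. \<psi> (x + \<phi> v)) \<longlongrightarrow> \<psi> (x + \<phi> v)) (at_left v)"
    using DERIV_isCont[OF psi_shift_deriv[OF x v]] by (simp add: isCont_def filterlim_at_split)
  have *: "set_integrable lborel {0<..<v} (dens x)" "(LBINT t=ereal 0..ereal v. dens x t) = \<psi> (x + \<phi> v)"
    using interval_integral_FTC_nonneg[of "ereal 0" "ereal v" "\<lambda>v. \<psi> (x + \<phi> v)" "dens x" 0 "\<psi> (x + \<phi> v)"] v x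
      lim0 \<open>(_ \<longlongrightarrow> _) (at_left v)\<close>
    by (auto simp: ereal_tendsto_simps psi_shift_deriv dens_isCont dens_nonneg)
  have "integrable lborel (\<lambda>t. indicator {v} t * dens x v)" by simp
  also have "(\<lambda>t. indicator {v} t * dens x v) = (\<lambda>t. indicator {v} t *\<^sub>R dens x t)"
    by (auto simp: indicator_def)
  finally have singleton: "set_integrable lborel {v} (dens x)" by (simp add: set_integrable_def)
  have "{0<..v} = {0<..<v} \<union> {v}" using v by auto
  then show "set_integrable lborel {0<..v} (dens x)"
    using set_integrable_Un[OF *(1) singleton] by simp
  show "(LINT t:{0<..v}|lborel. dens x t) = \<psi> (x + \<phi> v)"
    using * v by (simp add: interval_integral_Ioc)
qed

text \<open>The integrals identify \<open>P\<close>, \<open>R\<close> and their product almost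
  everywhere with \<open>dens x\<close>, \<open>dens z\<close> and \<open>dens (x + z)\<close>.
  Clearing denominators in \<open>dens x * dens z = dens (x + z)\<close> gives the equation for
  almost every \<open>\<phi> t\<close>, and continuity gives it at \<open>y\<close>.\<close>

lemma functional_equation_if_product_densities:
  fixes P R :: "real \<Rightarrow> real"
  assumes x: "0 \<le> x" and z: "0 \<le> z" and y: "0 < y"
    and [measurable]: "P \<in> borel_measurable borel" "R \<in> borel_measurable borel"
    and P: "\<And>v. 0 \<le> P v" "\<And>v. P v \<le> 1" and R: "\<And>v. 0 \<le> R v" "\<And>v. R v \<le> 1"
    and int_P: "\<And>v. 0 < v \<Longrightarrow> v < 1 \<Longrightarrow> (LINT t:{0<..v}|lborel. P t) = \<psi> (x + \<phi> v)"
    and int_R: "\<And>v. 0 < v \<Longrightarrow> v < 1 \<Longrightarrow> (LINT t:{0<..v}|lborel. R t) = \<psi> (z + \<phi> v)"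
    and int_PR: "\<And>v. 0 < v \<Longrightarrow> v < 1 \<Longrightarrow> (LINT t:{0<..v}|lborel. P t * R t) = \<psi> (x + z + \<phi> v)"
  shows "\<gamma> (x + z + y) * \<gamma> y = \<gamma> (x + y) * \<gamma> (z + y)"
proof (cases "\<psi> y = 0")
  case True
  have zero: "\<psi> u = 0" if "y \<le> u" for u
    using antimono[of y u] psi_nonneg[of u] True y that by simp
  have "\<gamma> u = 0" if "y \<le> u" for u
    using y that by (intro \<gamma>_eq_0 zero) auto
  then show ?thesis using x z by simp
next
  case False
  define v where "v = \<psi> y"
  have v: "0 < v" "v < 1" "\<phi> v = y"
    using False y psi_nonneg[of y] strict[of 0 y] by (auto simp: v_def)
  \<comment> \<open>An upper end strictly below 1 keeps the whole interval where \<open>dens\<close>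
    is controlled.\<close>
  obtain b where b: "v < b" "b < 1" using v dense by blast
  have AE: "AE t in lborel. t \<in> {0<..b} \<longrightarrow> Q t = dens w t"
    if [measurable]: "Q \<in> borel_measurable borel" and Q: "\<And>v. 0 \<le> Q v" "\<And>v. Q v \<le> 1" and w: "0 \<le> w"
      and int: "\<And>v. 0 < v \<Longrightarrow> v < 1 \<Longrightarrow> (LINT t:{0<..v}|lborel. Q t) = \<psi> (w + \<phi> v)" for Q w
  proof (rule AE_eq_if_interval_integrals_eq)
    show "set_integrable lborel {0<..b} Q"
      unfolding set_integrable_def
      by (rule Bochner_Integration.integrable_bound[where f = "indicator {0<..b} :: real \<Rightarrow> real"])
         (use Q b v in \<open>auto simp: indicator_def integrable_indicator_iff\<close>)
  qed (use b v w Q in \<open>auto simp: int dens_integral dens_nonneg\<close>)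
  define H where "H t = \<gamma> (x + z + \<phi> t) * \<gamma> (\<phi> t) - \<gamma> (x + \<phi> t) * \<gamma> (z + \<phi> t)" for t
  have "AE t in lborel. t \<in> {0<..b} \<longrightarrow> P t = dens x t"
    by (rule AE) (use P x int_P in auto)
  moreover have "AE t in lborel. t \<in> {0<..b} \<longrightarrow> R t = dens z t"
    by (rule AE) (use R z int_R in auto)
  moreover have "AE t in lborel. t \<in> {0<..b} \<longrightarrow> P t * R t = dens (x + z) t"
    by (rule AE) (use P R x z int_PR in \<open>auto intro: mult_le_one\<close>)
  ultimately have AE_H: "AE t in lborel. t \<in> {0<..b} \<longrightarrow> H t = 0"
  proof eventually_elim
    case (elim t)
    show ?case
    proof
      assume t: "t \<in> {0<..b}"
      then have "\<gamma> (\<phi> t) > 0" using b by (intro \<gamma>_\<phi>_pos) auto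
      moreover have "dens x t * dens z t = dens (x + z) t" using elim t by simp
      ultimately show "H t = 0" by (simp add: dens_def H_def field_simps)
    qed
  qed
  have "isCont H v"
    unfolding H_def using v x z \<gamma>_shift_isCont[of 0 v]
    by (intro isCont_diff isCont_mult \<gamma>_shift_isCont) auto
  have "H v = 0"
  proof (rule ccontr)
    assume "H v \<noteq> 0"
    then obtain e where e: "0 < e" "\<And>t. dist v t < e \<Longrightarrow> H t \<noteq> 0"
      using continuous_at_avoid[OF \<open>isCont H v\<close>] by blast
    \<comment> \<open>The interval \<open>{l<..<v}\<close> lies both in \<open>{0<..b}\<close> and
      in the ball where \<open>H\<close> is nonzero, yet it has positive length.\<close>
    define l where "l = max 0 (v - e)"
    have l: "l < v" "0 \<le> l" using v e by (auto simp: l_def)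
    have "AE t in lborel. t \<notin> {l<..<v}"
      using AE_H
    proof eventually_elim
      case (elim t)
      then show ?case using e(2)[of t] b v by (auto simp: l_def dist_real_def)
    qed
    then have "emeasure lborel {l<..<v} = 0"
      by (subst (asm) AE_iff_measurable[where N = "{l<..<v}"]) auto
    then show False using l by simp
  qed
  then show ?thesis by (simp add: H_def v)
qed

end

section \<open>Quantile functions and gaps\<close>

context cdf_distribution
begin

text \<open>With \<open>t\<close> the quantile of \<open>u\<close>, the level \<open>u\<close> lies
  between the left limit \<open>a\<close> and the value \<open>b\<close> of the distribution
  function at \<open>t\<close>. \<open>A\<close> vanishes at \<open>b\<close> because it is a value,
  at \<open>a\<close> as a value or a left limit of values, and in between because the open interval
  is a gap.\<close>

lemma eq_0_if_eq_0_on_range_cdf: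
  fixes A :: "real \<Rightarrow> real"
  assumes range: "\<And>t. A (cdf M t) = 0"
    and left: "\<And>a. 0 < a \<Longrightarrow> a < 1 \<Longrightarrow> (A \<longlongrightarrow> A a) (at_left a)"
    and affine: "\<And>a b t. 0 \<le> a \<Longrightarrow> a < b \<Longrightarrow> b \<le> 1 \<Longrightarrow> {a<..<b} \<inter> range (cdf M) = {} \<Longrightarrow> t \<in> {0..1} \<Longrightarrow>
      A ((1 - t) * a + t * b) = (1 - t) * A a + t * A b"
    and u: "0 < u" "u < 1"
  shows "A u = 0"
proof -
  define t where "t = I u"
  define a where "a = measure M {..<t}"
  define b where "b = cdf M t"
  have ub: "u \<le> b" using pseudoinverse[OF u, of t] by (simp add: t_def b_def)
  have lt_u: "cdf M s < u" if "s < t" for s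
    using pseudoinverse[OF u, of s] that by (simp add: t_def not_le[symmetric])
  have le_a: "cdf M s \<le> a" if "s < t" for s
    unfolding a_def cdf_def using that by (intro finite_measure_mono) auto
  have lim_a: "(cdf M \<longlongrightarrow> a) (at_left t)" unfolding a_def by (rule cdf_at_left)
  have ev: "\<forall>\<^sub>F s in at_left t. s < t" by (simp add: eventually_at_filter)
  have au: "a \<le> u"
    by (rule tendsto_upperbound[OF lim_a])
       (auto intro: eventually_mono[OF ev] less_imp_le[OF lt_u])
  have "0 \<le> a" by (simp add: a_def)
  \<comment> \<open>Either \<open>a\<close> is attained to the left of \<open>t\<close>, or the
    distribution function approaches \<open>a\<close> strictly from below there, and left-continuity
    of \<open>A\<close> applies.\<close>
  have "A a = 0"
  proof (cases "\<exists>s<t. a \<le> cdf M s")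
    case True
    then show ?thesis using le_a range by (metis order_antisym)
  next
    case False
    have "cdf M (t - 1) < a" using False by (metis less_add_one diff_less_eq not_le)
    then have "0 < a" using cdf_nonneg[of "t - 1"] by linarith
    moreover have "filterlim (cdf M) (at_left a) (at_left t)"
      unfolding filterlim_at using lim_a False by (auto intro!: eventually_mono[OF ev] simp: not_le)
    ultimately have "((\<lambda>s. A (cdf M s)) \<longlongrightarrow> A a) (at_left t)"
      using au u by (intro filterlim_compose[OF left]) auto
    then show ?thesis by (simp add: range tendsto_const_iff)
  qed
  show ?thesis
  proof (cases "u = a \<or> u = b")
    case True
    then show ?thesis using \<open>A a = 0\<close> range[of t] by (auto simp: b_def)
  next
    case False
    then have lt: "a < u" "u < b" using au ub by auto
    have gap: "{a<..<b} \<inter> range (cdf M) = {}"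
    proof safe
      fix s assume s: "cdf M s \<in> {a<..<b}"
      then show "cdf M s \<in> {}"
        using le_a[of s] cdf_nondecreasing[of t s] by (cases "s < t") (auto simp: b_def)
    qed
    define r where "r = (u - a) / (b - a)"
    have "r * (b - a) = u - a" using lt by (simp add: r_def)
    then have "u = (1 - r) * a + r * b" by (simp add: algebra_simps)
    moreover have "r \<in> {0..1}" using lt by (simp add: r_def)
    moreover have "b \<le> 1" using cdf_bounded_prob by (simp add: b_def)
    ultimately have "A u = (1 - r) * A a + r * A b"
      using affine[OF \<open>0 \<le> a\<close> _ _ gap] lt by simp
    then show ?thesis using \<open>A a = 0\<close> range[of t] by (simp add: b_def)
  qed
qed

text \<open>\<open>I\<close> is a pseudoinverse of the distribution function on the open unit
  interval only, whence the indicator.\<close>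

definition quantile_comp :: "(real \<Rightarrow> real) \<Rightarrow> real \<Rightarrow> real" where
  "quantile_comp h s = indicator {0<..<1} s * h (I s)"

lemma quantile_comp_bounds:
  "(\<And>t. 0 \<le> h t) \<Longrightarrow> 0 \<le> quantile_comp h s" "(\<And>t. h t \<le> 1) \<Longrightarrow> quantile_comp h s \<le> 1"
  by (auto simp: quantile_comp_def indicator_def)

lemma quantile_comp_measurable:
  assumes "h \<in> borel_measurable borel" shows "quantile_comp h \<in> borel_measurable borel"
proof -
  have "(\<lambda>s. h (I s)) \<in> borel_measurable (restrict_space borel {0<..<1})"
    using measurable_compose[OF measurable_CI assms] .
  then show ?thesis
    by (simp add: borel_measurable_restrict_space_iff quantile_comp_def [abs_def])
qed

text \<open>\<open>M\<close> is the image of Lebesgue measure on the open unit interval under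
  \<open>I\<close>, and \<open>I s \<le> t\<close> is equivalent to
  \<open>s \<le> cdf M t\<close>.\<close>

lemma integral_atMost_eq_quantile_integral:
  assumes h [measurable]: "h \<in> borel_measurable borel"
  shows "(\<integral>x. indicator {..t} x * h x \<partial>M) = (LINT s:{0<..cdf M t}|lborel. quantile_comp h s)"
proof -
  have "(\<integral>x. indicator {..t} x * h x \<partial>M)
      = (\<integral>x. indicator {..t} x * h x \<partial>distr (restrict_space lborel {0<..<1}) borel I)"
    by (simp add: distr_I_eq_M)
  also have "\<dots> = (\<integral>s. indicator {..t} (I s) * h (I s) \<partial>restrict_space lborel {0<..<1})"
  proof (rule integral_distr)
    show "I \<in> borel_measurable (restrict_space lborel {0<..<1})"
      using measurable_CI
      by (subst measurable_cong_sets[where M' = "restrict_space borel {0<..<1}" and N' = borel])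
         (simp_all add: sets_restrict_space)
  qed simp
  also have "\<dots> = (\<integral>s. indicator {0<..<1} s *\<^sub>R (indicator {..t} (I s) * h (I s)) \<partial>lborel)"
    by (subst integral_restrict_space) auto
  also have "\<dots> = (\<integral>s. indicator {0<..cdf M t} s *\<^sub>R quantile_comp h s \<partial>lborel)"
  proof (rule Bochner_Integration.integral_cong)
    fix s :: real
    show "indicator {0<..<1} s *\<^sub>R (indicator {..t} (I s) * h (I s)) = indicator {0<..cdf M t} s *\<^sub>R quantile_comp h s"
      using pseudoinverse[of s t] by (cases "s \<in> {0<..<1}") (auto simp: quantile_comp_def indicator_def)
  qed simp
  finally show ?thesis by (simp add: set_lebesgue_integral_def)
qed

text \<open>Both sides agree at the values of the distribution function. The left side is
  continuous, its integrand being bounded by 1, and affine on gaps, where the quantile is constant;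
  \<open>eq_0_if_eq_0_on_range_cdf\<close> applies to the difference.\<close>

lemma quantile_integral_eq:
  fixes K :: "real \<Rightarrow> real"
  assumes h [measurable]: "h \<in> borel_measurable borel" and h_bd: "\<And>t. 0 \<le> h t" "\<And>t. h t \<le> 1"
    and K: "\<And>t. (\<integral>x. indicator {..t} x * h x \<partial>M) = K (cdf M t)"
    and left: "\<And>a. 0 < a \<Longrightarrow> a < 1 \<Longrightarrow> (K \<longlongrightarrow> K a) (at_left a)"
    and affine: "\<And>a b t. 0 \<le> a \<Longrightarrow> a < b \<Longrightarrow> b \<le> 1 \<Longrightarrow> {a<..<b} \<inter> range (cdf M) = {} \<Longrightarrow> t \<in> {0..1} \<Longrightarrow>
      K ((1 - t) * a + t * b) = (1 - t) * K a + t * K b"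
    and v: "0 < v" "v < 1"
  shows "(LINT s:{0<..v}|lborel. quantile_comp h s) = K v"
proof -
  define P where "P = quantile_comp h"
  define H where "H v = (LINT s:{0<..v}|lborel. P s)" for v
  have [measurable]: "P \<in> borel_measurable borel" unfolding P_def by (rule quantile_comp_measurable[OF h])
  have P: "0 \<le> P s" "P s \<le> 1" for s unfolding P_def using quantile_comp_bounds h_bd by blast+
  have int: "set_integrable lborel {a<..b} P" for a b
  proof -
    have "integrable lborel (indicator {a<..b} :: real \<Rightarrow> real)"
      by (cases "a \<le> b") (simp_all add: integrable_indicator_iff)
    then show ?thesis unfolding set_integrable_def
      by (rule Bochner_Integration.integrable_bound) (use P in \<open>auto split: split_indicator\<close>)
  qed
  have split: "H y = H a + (LINT s:{a<..y}|lborel. P s)" if "0 \<le> a" "a \<le> y" for a y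
  proof -
    have "{0<..y} = {0<..a} \<union> {a<..y}" using that by auto
    moreover have "(LINT s:{0<..a} \<union> {a<..y}|lborel. P s) = (LINT s:{0<..a}|lborel. P s) + (LINT s:{a<..y}|lborel. P s)"
      by (rule set_integral_Un[OF _ int int]) auto
    ultimately show ?thesis unfolding H_def by (simp only:)
  qed
  have "K v - H v = 0"
  proof (rule eq_0_if_eq_0_on_range_cdf[where A = "\<lambda>v. K v - H v", OF _ _ _ v])
    show "K (cdf M t) - H (cdf M t) = 0" for t
      using K[of t] integral_atMost_eq_quantile_integral[OF h, of t] by (simp add: H_def P_def)
    show "((\<lambda>v. K v - H v) \<longlongrightarrow> K a - H a) (at_left a)" if a: "0 < a" "a < 1" for a
    proof (intro tendsto_diff left a)
      have "\<forall>\<^sub>F s in at_left a. s \<in> {0<..<a}" using a by (intro eventually_at_left_real) auto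
      then have ev: "\<forall>\<^sub>F s in at_left a. norm (H s - H a) \<le> norm (a - s)"
      proof eventually_elim
        case (elim s)
        have "0 \<le> (LINT t:{s<..a}|lborel. P t)"
          unfolding set_lebesgue_integral_def by (intro Bochner_Integration.integral_nonneg) (simp add: P)
        moreover have "(LINT t:{s<..a}|lborel. P t) \<le> (LINT t:{s<..a}|lborel. 1)"
          by (rule set_integral_mono[OF int]) (use elim P in \<open>simp_all add: set_integrable_def integrable_indicator_iff\<close>)
        moreover have "(LINT t:{s<..a}|lborel. (1 :: real)) = a - s"
          using elim by (simp add: set_lebesgue_integral_def)
        ultimately show ?case using split[of s a] elim by simp
      qed
      have "((\<lambda>s. a - s) \<longlongrightarrow> a - a) (at_left a)" by (intro tendsto_intros)
      then have "((\<lambda>s. a - s) \<longlongrightarrow> 0) (at_left a)" by simp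
      then show "(H \<longlongrightarrow> H a) (at_left a)"
        using Lim_null_comparison[OF ev tendsto_norm_zero] by (simp add: LIM_zero_iff)
    qed
    fix a b t :: real
    assume ab: "0 \<le> a" "a < b" "b \<le> 1" "{a<..<b} \<inter> range (cdf M) = {}" and t: "t \<in> {0..1}"
    define c where "c = P ((a + b) / 2)"
    have P_c: "P s = c" if "a < s" "s < b" for s
    proof -
      \<comment> \<open>For levels \<open>r\<close> inside the gap, the set of all \<open>x\<close>
        with \<open>r \<le> cdf M x\<close> does not depend on \<open>r\<close>; the quantile is the
        infimum of this set.\<close>
      have le: "r \<le> cdf M x \<longleftrightarrow> b \<le> cdf M x" if "a < r" "r < b" for r x
      proof -
        have "cdf M x \<notin> {a<..<b}" using ab(4) by blast
        then show ?thesis using that by auto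
      qed
      have "s \<le> cdf M x \<longleftrightarrow> b \<le> cdf M x" "(a + b) / 2 \<le> cdf M x \<longleftrightarrow> b \<le> cdf M x" for x
        using that ab(2) by (intro le; simp)+
      then show ?thesis using that ab by (simp add: c_def P_def quantile_comp_def)
    qed
    have H_c: "H y = H a + c * (y - a)" if y: "a \<le> y" "y \<le> b" for y
    proof -
      have "(LINT s:{a<..y}|lborel. P s) = (\<integral>s. indicator {a<..y} s * c \<partial>lborel)"
        unfolding set_lebesgue_integral_def
      proof (rule integral_cong_AE)
        show "AE s in lborel. indicator {a<..y} s *\<^sub>R P s = indicator {a<..y} s * c"
          \<comment> \<open>When \<open>y = b\<close>, the integrand need not equal \<open>c\<close>
            at the endpoint itself.\<close>
          using AE_lborel_singleton[of b] by eventually_elim (use y P_c in \<open>auto simp: indicator_def\<close>)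
      qed auto
      also have "\<dots> = c * (y - a)" using y by simp
      finally show ?thesis using split[of a y] ab y by simp
    qed
    have y: "(1 - t) * a + t * b = a + t * (b - a)" "0 \<le> t * (b - a)" "t * (b - a) \<le> b - a"
      using t ab mult_left_le_one_le[of "b - a" t] mult_left_mono[of a b t] by (auto simp: left_diff_distrib right_diff_distrib)
    have K_y: "K (a + t * (b - a)) = (1 - t) * K a + t * K b"
      using affine[OF ab t] y(1) by simp
    have H_y: "H (a + t * (b - a)) = H a + c * (t * (b - a))" "H b = H a + c * (b - a)"
      using H_c[of "a + t * (b - a)"] H_c[of b] y ab by simp_all
    show "K ((1 - t) * a + t * b) - H ((1 - t) * a + t * b) = (1 - t) * (K a - H a) + t * (K b - H b)"
      unfolding y(1) K_y H_y by (simp add: algebra_simps)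
  qed
  then show ?thesis by (simp add: H_def P_def)
qed

end

section \<open>Conditional densities along a Markov chain\<close>

text \<open>\<open>p\<close> is a version of the probability of \<open>E\<close> given
  \<open>Y = t\<close>: the density, with respect to the law \<mu> of \<open>Y\<close>, of the
  measure \<nu> of \<open>E\<close> intersected with preimages under \<open>Y\<close>. Domination of
  \<nu> by \<mu> puts the density in the unit interval.\<close>

lemma (in prob_space) obtain_conditional_density:
  fixes Y :: "'a \<Rightarrow> real"
  assumes E [measurable]: "E \<in> events" and Y [measurable]: "Y \<in> borel_measurable M"
  obtains p :: "real \<Rightarrow> real" where "p \<in> borel_measurable borel" "\<And>t. 0 \<le> p t" "\<And>t. p t \<le> 1"
    "\<And>h. h \<in> borel_measurable borel \<Longrightarrow>
      (\<integral>\<omega>. indicator E \<omega> * h (Y \<omega>) \<partial>M) = (\<integral>t. p t * h t \<partial>distr M borel Y)"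
proof -
  define \<mu> where "\<mu> = distr M borel Y"
  interpret \<mu>: prob_space \<mu> unfolding \<mu>_def by (rule prob_space_distr) simp
  have [measurable_cong, simp]: "sets \<mu> = sets borel" by (simp add: \<mu>_def)
  have [simp]: "space \<mu> = UNIV" by (simp add: \<mu>_def)
  define \<nu> where "\<nu> = distr (density M (indicator E)) borel Y"
  have \<nu>: "emeasure \<nu> A = emeasure M (E \<inter> (Y -` A \<inter> space M))" if [measurable]: "A \<in> sets borel" for A
  proof -
    have "emeasure \<nu> A = emeasure (density M (indicator E)) (Y -` A \<inter> space M)"
      unfolding \<nu>_def by (subst emeasure_distr) auto
    also have "\<dots> = (\<integral>\<^sup>+\<omega>. indicator (E \<inter> (Y -` A \<inter> space M)) \<omega> \<partial>M)"
      by (subst emeasure_density) (simp_all add: indicator_inter_arith[symmetric])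
    also have "\<dots> = emeasure M (E \<inter> (Y -` A \<inter> space M))" by (rule nn_integral_indicator) simp
    finally show ?thesis .
  qed
  have \<nu>_le: "emeasure \<nu> A \<le> emeasure \<mu> A" if [measurable]: "A \<in> sets borel" for A
  proof -
    have "emeasure \<mu> A = emeasure M (Y -` A \<inter> space M)"
      unfolding \<mu>_def by (rule emeasure_distr) simp_all
    moreover have "emeasure M (E \<inter> (Y -` A \<inter> space M)) \<le> emeasure M (Y -` A \<inter> space M)"
      by (rule emeasure_mono) (auto intro: measurable_sets)
    ultimately show ?thesis unfolding \<nu>[OF that] by simp
  qed
  have "absolutely_continuous \<mu> \<nu>"
    unfolding absolutely_continuous_def
  proof
    fix A assume "A \<in> null_sets \<mu>"
    then show "A \<in> null_sets \<nu>" using \<nu>_le[of A] by (auto simp: null_sets_def \<nu>_def)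
  qed
  then obtain f where f [measurable]: "f \<in> borel_measurable borel" and f\<nu>: "density \<mu> f = \<nu>"
    using \<mu>.Radon_Nikodym[of \<nu>] by (auto simp: \<nu>_def measurable_cong_sets[of \<mu> borel])
  have f_int: "(\<integral>\<^sup>+t. f t * indicator A t \<partial>\<mu>) = emeasure \<nu> A" if "A \<in> sets borel" for A
    using that unfolding f\<nu>[symmetric] by (subst emeasure_density) auto
  have fin: "AE t in \<mu>. f t \<noteq> \<infinity>"
    using f_int[of UNIV] \<nu>_le[of UNIV] by (intro nn_integral_noteq_infinite) (auto simp: top_unique)
  define g where "g t = enn2real (f t)" for t
  have [measurable]: "g \<in> borel_measurable borel" unfolding g_def by measurable
  have fg: "AE t in \<mu>. f t = ennreal (g t)"
    using fin by eventually_elim (simp add: g_def less_top)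
  have g_int: "(\<integral>\<^sup>+t. ennreal (indicator A t * g t) \<partial>\<mu>) = emeasure \<nu> A" if A: "A \<in> sets borel" for A
  proof -
    have "(\<integral>\<^sup>+t. ennreal (indicator A t * g t) \<partial>\<mu>) = (\<integral>\<^sup>+t. f t * indicator A t \<partial>\<mu>)"
      by (rule nn_integral_cong_AE, use fg in eventually_elim) (auto simp: indicator_def)
    then show ?thesis using f_int[OF A] by simp
  qed
  have "emeasure \<nu> UNIV < \<top>"
    by (rule le_less_trans[OF \<nu>_le]) (auto simp: less_top[symmetric])
  then have "integrable \<mu> g"
    using g_int[of UNIV] by (intro integrableI_nonneg) (auto simp: g_def)
  \<comment> \<open>Averages in \<open>{0..1}\<close> over all sets of positive measure force almost
    all values into that closed set.\<close>
  moreover have "(1 / measure \<mu> A) *\<^sub>R set_lebesgue_integral \<mu> A g \<in> {0..1}"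
    if A: "A \<in> sets \<mu>" "measure \<mu> A > 0" for A
  proof -
    have "ennreal (set_lebesgue_integral \<mu> A g) = emeasure \<nu> A"
      unfolding set_lebesgue_integral_def using g_int[of A] A integrable_mult_indicator[OF A(1) \<open>integrable \<mu> g\<close>]
      by (subst nn_integral_eq_integral[symmetric]) (auto simp: g_def)
    also have "\<dots> \<le> ennreal (measure \<mu> A)"
      using \<nu>_le[of A] A by (simp add: \<mu>.emeasure_eq_measure)
    finally have "set_lebesgue_integral \<mu> A g \<le> measure \<mu> A" by simp
    moreover have "0 \<le> set_lebesgue_integral \<mu> A g"
      unfolding set_lebesgue_integral_def by (intro Bochner_Integration.integral_nonneg) (simp add: g_def)
    ultimately show ?thesis using A by simp
  qed
  ultimately have g01: "AE t in \<mu>. g t \<in> {0..1}"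
    by (intro \<mu>.averaging_theorem) auto
  \<comment> \<open>Clamping changes \<open>g\<close> on a null set only and makes the bounds hold
    everywhere.\<close>
  define p where "p t = max 0 (min 1 (g t))" for t
  have [measurable]: "p \<in> borel_measurable borel" unfolding p_def by measurable
  have p: "0 \<le> p t" "p t \<le> 1" for t by (auto simp: p_def)
  have "density \<mu> (\<lambda>t. ennreal (p t)) = density \<mu> f"
    by (rule density_cong, simp_all, use fg g01 in eventually_elim) (simp add: p_def)
  then have p\<nu>: "density \<mu> (\<lambda>t. ennreal (p t)) = \<nu>" using f\<nu> by simp
  have "(\<integral>\<omega>. indicator E \<omega> * h (Y \<omega>) \<partial>M) = (\<integral>t. p t * h t \<partial>distr M borel Y)"
    if [measurable]: "h \<in> borel_measurable borel" for h
  proof -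
    have "(\<integral>t. p t * h t \<partial>\<mu>) = (\<integral>t. h t \<partial>\<nu>)"
      unfolding p\<nu>[symmetric] by (subst integral_density) (auto simp: p)
    also have "\<dots> = (\<integral>\<omega>. h (Y \<omega>) \<partial>density M (indicator E))"
      unfolding \<nu>_def by (subst integral_distr) auto
    also have "density M (indicator E) = density M (\<lambda>\<omega>. ennreal (indicator E \<omega>))"
      by (simp add: ennreal_indicator)
    also have "(\<integral>\<omega>. h (Y \<omega>) \<partial>\<dots>) = (\<integral>\<omega>. indicator E \<omega> * h (Y \<omega>) \<partial>M)"
      by (subst integral_density) auto
    finally show ?thesis by (simp add: \<mu>_def)
  qed
  then show ?thesis by (intro that[of p]) (auto simp: p)
qed

text \<open>\<open>p\<close> and \<open>q\<close> are the conditional probabilities of the events on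
  \<open>X 1\<close> and \<open>X 3\<close> given \<open>X 2\<close>. By the Markov property at
  \<open>k = 2\<close>, conditioning the event on \<open>X 3\<close> on the pair
  \<open>(X 1, X 2)\<close> gives \<open>q (X 2)\<close>; the defining property of \<open>p\<close>,
  applied to \<open>q\<close> times an indicator, produces the product.\<close>

lemma (in prob_space) markov_chain_densities:
  assumes X [measurable]: "X 1 \<in> borel_measurable M" "X 2 \<in> borel_measurable M" "X 3 \<in> borel_measurable M"
    and n: "3 \<le> n" and markov: "markov_chain M n X"
  obtains p q :: "real \<Rightarrow> real" where
    "p \<in> borel_measurable borel" "\<And>t. 0 \<le> p t" "\<And>t. p t \<le> 1"
    "q \<in> borel_measurable borel" "\<And>t. 0 \<le> q t" "\<And>t. q t \<le> 1"
    "\<And>t. measure M {\<omega> \<in> space M. X 1 \<omega> \<le> x \<and> X 2 \<omega> \<le> t}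
      = (\<integral>s. indicator {..t} s * p s \<partial>distr M borel (X 2))"
    "\<And>t. measure M {\<omega> \<in> space M. X 2 \<omega> \<le> t \<and> X 3 \<omega> \<le> z}
      = (\<integral>s. indicator {..t} s * q s \<partial>distr M borel (X 2))"
    "\<And>t. measure M {\<omega> \<in> space M. X 1 \<omega> \<le> x \<and> X 2 \<omega> \<le> t \<and> X 3 \<omega> \<le> z}
      = (\<integral>s. indicator {..t} s * (p s * q s) \<partial>distr M borel (X 2))"
proof -
  define E where "E = {\<omega> \<in> space M. X 1 \<omega> \<le> x}"
  define G where "G = {\<omega> \<in> space M. X 3 \<omega> \<le> z}"
  have ev [measurable]: "E \<in> events" "G \<in> events" unfolding E_def G_def by measurable
  obtain p :: "real \<Rightarrow> real" where p [measurable]: "p \<in> borel_measurable borel" and p01: "\<And>t. 0 \<le> p t" "\<And>t. p t \<le> 1"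
    and pE: "\<And>h. h \<in> borel_measurable borel \<Longrightarrow>
      (\<integral>\<omega>. indicator E \<omega> * h (X 2 \<omega>) \<partial>M) = (\<integral>t. p t * h t \<partial>distr M borel (X 2))"
    by (rule obtain_conditional_density[OF ev(1) X(2)]) (rule that)
  obtain q :: "real \<Rightarrow> real" where q [measurable]: "q \<in> borel_measurable borel" and q01: "\<And>t. 0 \<le> q t" "\<And>t. q t \<le> 1"
    and qG: "\<And>h. h \<in> borel_measurable borel \<Longrightarrow>
      (\<integral>\<omega>. indicator G \<omega> * h (X 2 \<omega>) \<partial>M) = (\<integral>t. q t * h t \<partial>distr M borel (X 2))"
    by (rule obtain_conditional_density[OF ev(2) X(2)]) (rule that)
  define F1 where "F1 = vimage_algebra (space M) (X 2) borel"
  define XX where "XX \<omega> = (\<lambda>i\<in>{1..2::nat}. X i \<omega>)" for \<omega>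
  define F2 where "F2 = vimage_algebra (space M) XX (Pi\<^sub>M {1..2} (\<lambda>_. borel :: real measure))"
  have X_i: "X i \<in> borel_measurable M" if "i \<in> {1..2}" for i
    using that X by (cases "i = 1") (auto simp: numeral_2_eq_2 le_Suc_eq)
  have XX: "XX \<in> measurable M (Pi\<^sub>M {1..2} (\<lambda>_. borel))"
    unfolding XX_def by (rule measurable_restrict) (rule X_i)
  have sub: "subalgebra M F1" "subalgebra M F2"
    using sets_image_in_sets[OF refl X(2)] sets_image_in_sets[OF refl XX]
    by (simp_all add: subalgebra_def F1_def F2_def)
  interpret F1: sigma_finite_subalgebra M F1
    by (intro finite_measure_subalgebra_is_sigma_finite finite_measure_subalgebra.intro)
       (unfold_locales, rule sub)
  interpret F2: sigma_finite_subalgebra M F2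
    by (intro finite_measure_subalgebra_is_sigma_finite finite_measure_subalgebra.intro)
       (unfold_locales, rule sub)
  have int_G: "integrable M (indicat_real G)"
    by (simp add: integrable_indicator_iff less_top[symmetric])
  have prob_eq: "measure M A = (\<integral>\<omega>. indicat_real A \<omega> \<partial>M)" if "A \<in> events" for A
    using sets.sets_into_space[OF that] by (simp add: Int_absorb2)
  have G_eq: "X (Suc 2) -` {..z} \<inter> space M = G" by (auto simp: G_def numeral_3_eq_3 numeral_2_eq_2)
  have "AE \<omega> in M. real_cond_exp M F2 (indicator G) \<omega> = real_cond_exp M F1 (indicator G) \<omega>"
    using markov[unfolded markov_chain_def, rule_format, of 2 "{..z}"] n
    unfolding F1_def F2_def XX_def G_eq by simp
  \<comment> \<open>Conditional expectation is characterised by its integrals over the sets of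
    \<open>F1\<close>, which are the preimages of Borel sets under \<open>X 2\<close>.\<close>
  moreover have "AE \<omega> in M. real_cond_exp M F1 (indicator G) \<omega> = q (X 2 \<omega>)"
  proof (rule F1.real_cond_exp_charact)
    fix A assume "A \<in> sets F1"
    then obtain B where B [measurable]: "B \<in> sets borel" and A: "A = X 2 -` B \<inter> space M"
      unfolding F1_def by (auto simp: sets_vimage_algebra2)
    have "(\<integral>\<omega>\<in>A. indicat_real G \<omega> \<partial>M) = (\<integral>\<omega>. indicat_real G \<omega> * indicat_real B (X 2 \<omega>) \<partial>M)"
      unfolding set_lebesgue_integral_def A
      by (rule Bochner_Integration.integral_cong) (auto simp: indicator_def)
    also have "\<dots> = (\<integral>t. q t * indicat_real B t \<partial>distr M borel (X 2))"
      by (rule qG) simp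
    also have "\<dots> = (\<integral>\<omega>. q (X 2 \<omega>) * indicat_real B (X 2 \<omega>) \<partial>M)"
      by (subst integral_distr) auto
    also have "\<dots> = (\<integral>\<omega>\<in>A. q (X 2 \<omega>) \<partial>M)"
      unfolding set_lebesgue_integral_def A
      by (rule Bochner_Integration.integral_cong) (auto simp: indicator_def)
    finally show "(\<integral>\<omega>\<in>A. indicat_real G \<omega> \<partial>M) = (\<integral>\<omega>\<in>A. q (X 2 \<omega>) \<partial>M)" .
  next
    show "integrable M (\<lambda>\<omega>. q (X 2 \<omega>))"
      by (rule integrable_const_bound[where B = 1]) (auto simp: q01)
    show "(\<lambda>\<omega>. q (X 2 \<omega>)) \<in> borel_measurable F1"
      unfolding F1_def by (rule measurable_compose[OF measurable_vimage_algebra1 q]) auto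
  qed (rule int_G)
  ultimately have cond: "AE \<omega> in M. real_cond_exp M F2 (indicator G) \<omega> = q (X 2 \<omega>)"
    by eventually_elim simp
  show ?thesis
  proof (rule that[OF p p01 q q01])
    fix t
    have "measure M {\<omega> \<in> space M. X 1 \<omega> \<le> x \<and> X 2 \<omega> \<le> t} = (\<integral>\<omega>. indicator {\<omega> \<in> space M. X 1 \<omega> \<le> x \<and> X 2 \<omega> \<le> t} \<omega> \<partial>M)"
      by (rule prob_eq) measurable
    also have "\<dots> = (\<integral>\<omega>. indicat_real E \<omega> * indicat_real {..t} (X 2 \<omega>) \<partial>M)"
      by (rule Bochner_Integration.integral_cong) (auto simp: indicator_def E_def)
    also have "\<dots> = (\<integral>s. p s * indicat_real {..t} s \<partial>distr M borel (X 2))"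
      by (rule pE) simp
    finally show "measure M {\<omega> \<in> space M. X 1 \<omega> \<le> x \<and> X 2 \<omega> \<le> t}
        = (\<integral>s. indicator {..t} s * p s \<partial>distr M borel (X 2))"
      by (simp add: mult.commute)
    have "measure M {\<omega> \<in> space M. X 2 \<omega> \<le> t \<and> X 3 \<omega> \<le> z} = (\<integral>\<omega>. indicator {\<omega> \<in> space M. X 2 \<omega> \<le> t \<and> X 3 \<omega> \<le> z} \<omega> \<partial>M)"
      by (rule prob_eq) measurable
    also have "\<dots> = (\<integral>\<omega>. indicat_real G \<omega> * indicat_real {..t} (X 2 \<omega>) \<partial>M)"
      by (rule Bochner_Integration.integral_cong) (auto simp: indicator_def G_def)
    also have "\<dots> = (\<integral>s. q s * indicat_real {..t} s \<partial>distr M borel (X 2))"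
      by (rule qG) simp
    finally show "measure M {\<omega> \<in> space M. X 2 \<omega> \<le> t \<and> X 3 \<omega> \<le> z}
        = (\<integral>s. indicator {..t} s * q s \<partial>distr M borel (X 2))"
      by (simp add: mult.commute)
    define A where "A = {\<omega> \<in> space M. X 1 \<omega> \<le> x \<and> X 2 \<omega> \<le> t}"
    \<comment> \<open>Membership in \<open>F2\<close> allows replacing the indicator of
      \<open>G\<close> by its conditional expectation under the integral over
      \<open>A\<close>.\<close>
    have A: "A \<in> sets F2"
    proof -
      have "A = XX -` {f \<in> space (Pi\<^sub>M {1..2} (\<lambda>_. borel)). f 1 \<le> x \<and> f 2 \<le> t} \<inter> space M"
        using measurable_space[OF XX] by (auto simp: A_def XX_def)
      also have "\<dots> \<in> sets F2"
        unfolding F2_def by (rule in_vimage_algebra) measurable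
      finally show ?thesis .
    qed
    have [measurable]: "A \<in> events" unfolding A_def by measurable
    have "measure M {\<omega> \<in> space M. X 1 \<omega> \<le> x \<and> X 2 \<omega> \<le> t \<and> X 3 \<omega> \<le> z} = measure M (A \<inter> G)"
      by (rule arg_cong[where f = "measure M"]) (auto simp: A_def G_def)
    also have "\<dots> = (\<integral>\<omega>. indicat_real (A \<inter> G) \<omega> \<partial>M)" by (rule prob_eq) measurable
    also have "\<dots> = (\<integral>\<omega>\<in>A. indicat_real G \<omega> \<partial>M)"
      unfolding set_lebesgue_integral_def by (simp add: indicator_inter_arith)
    also have "\<dots> = (\<integral>\<omega>\<in>A. real_cond_exp M F2 (indicator G) \<omega> \<partial>M)"
      by (rule F2.real_cond_exp_intA[OF int_G A])
    also have "\<dots> = (\<integral>\<omega>. indicator E \<omega> * (indicator {..t} (X 2 \<omega>) * q (X 2 \<omega>)) \<partial>M)"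
      unfolding set_lebesgue_integral_def
    proof (rule integral_cong_AE)
      show "AE \<omega> in M. indicator A \<omega> *\<^sub>R real_cond_exp M F2 (indicator G) \<omega>
          = indicator E \<omega> * (indicator {..t} (X 2 \<omega>) * q (X 2 \<omega>))"
        using cond AE_space by eventually_elim (auto simp: A_def E_def indicator_def)
    qed auto
    also have "\<dots> = (\<integral>s. p s * (indicator {..t} s * q s) \<partial>distr M borel (X 2))"
      by (rule pE) simp
    finally show "measure M {\<omega> \<in> space M. X 1 \<omega> \<le> x \<and> X 2 \<omega> \<le> t \<and> X 3 \<omega> \<le> z}
        = (\<integral>s. indicator {..t} s * (p s * q s) \<partial>distr M borel (X 2))"
      by (simp add: mult_ac)
  qed
qed

section \<open>Archimedean copulas\<close>

lemma is_copula_representation: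
  assumes "is_copula n C"
  obtains N where "prob_space N" "sets N = sets (Pi\<^sub>M {1..n} (\<lambda>_. borel :: real measure))"
    "\<And>i. i \<in> {1..n} \<Longrightarrow> distr N borel (\<lambda>x. x i) = uniform_measure lborel {0..1}"
    "\<And>u. u \<in> {1..n} \<rightarrow> {0..1} \<Longrightarrow> C u = joint_cdf N n (\<lambda>i x. x i) u"
    "\<And>i. i \<in> {1..n} \<Longrightarrow> (\<lambda>x. x i) \<in> borel_measurable N"
proof -
  obtain N where N: "prob_space N" "sets N = sets (Pi\<^sub>M {1..n} (\<lambda>_. borel :: real measure))"
    "\<And>i. i \<in> {1..n} \<Longrightarrow> distr N borel (\<lambda>x. x i) = uniform_measure lborel {0..1}"
    "\<And>u. u \<in> {1..n} \<rightarrow> {0..1} \<Longrightarrow> C u = joint_cdf N n (\<lambda>i x. x i) u"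
    using assms unfolding is_copula_def by blast
  then show ?thesis by (intro that) (auto simp: measurable_cong_sets[OF N(2) refl])
qed

text \<open>\<open>C\<close> takes functions on all of \<open>nat\<close>, but on the cube it is a
  \<open>joint_cdf\<close>, which reads the coordinates in \<open>{1..n}\<close> only.\<close>

lemma is_copula_cong:
  assumes C: "is_copula n C" and u: "u \<in> {1..n} \<rightarrow> {0..1}" and eq: "\<And>i. i \<in> {1..n} \<Longrightarrow> u i = v i"
  shows "C u = C v"
proof -
  obtain N where "\<And>u. u \<in> {1..n} \<rightarrow> {0..1} \<Longrightarrow> C u = joint_cdf N n (\<lambda>i x. x i) u"
    using is_copula_representation[OF C] by metis
  moreover have "v \<in> {1..n} \<rightarrow> {0..1}" using u eq by (auto simp: Pi_iff)
  ultimately show ?thesis using u eq by (simp add: joint_cdf_def)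
qed

text \<open>The event lies in the set where the \<open>i\<close>-th coordinate is at most 0, which
  is null under a uniform marginal.\<close>

lemma is_copula_eq_0:
  assumes C: "is_copula n C" and u: "u \<in> {1..n} \<rightarrow> {0..1}" and i: "i \<in> {1..n}" "u i = 0"
  shows "C u = 0"
proof -
  obtain N where N: "prob_space N"
    "\<And>i. i \<in> {1..n} \<Longrightarrow> distr N borel (\<lambda>x. x i) = uniform_measure lborel {0..1}"
    "\<And>u. u \<in> {1..n} \<rightarrow> {0..1} \<Longrightarrow> C u = joint_cdf N n (\<lambda>i x. x i) u"
    "\<And>i. i \<in> {1..n} \<Longrightarrow> (\<lambda>x. x i) \<in> borel_measurable N"
    using is_copula_representation[OF C] by metis
  interpret prob_space N by fact
  have [measurable]: "(\<lambda>x. x i) \<in> borel_measurable N" using N(4) i by blast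
  have "C u = measure N {x \<in> space N. \<forall>j\<in>{1..n}. x j \<le> u j}"
    using N(3)[OF u] by (simp add: joint_cdf_def)
  also have "\<dots> \<le> measure N ((\<lambda>x. x i) -` {..0} \<inter> space N)"
    by (rule finite_measure_mono) (use i in \<open>auto dest!: bspec[where x = i]\<close>)
  also have "\<dots> = measure (distr N borel (\<lambda>x. x i)) {..0}"
    by (rule measure_distr[symmetric]) simp_all
  also have "distr N borel (\<lambda>x. x i) = uniform_measure lborel {0..1}" by (rule N(2)[OF i(1)])
  also have "measure \<dots> {..0} = measure lborel ({0..1} \<inter> {..0::real})"
    by (simp add: measure_uniform_measure)
  also have "{0..1} \<inter> {..0::real} = {0}" by auto
  finally have "C u \<le> 0" by simp
  moreover have "0 \<le> C u" using N(3)[OF u] by (simp add: joint_cdf_def)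
  ultimately show ?thesis by simp
qed

text \<open>Putting 1 in the remaining coordinates restricts a copula to its first three-dimensional
  margin.\<close>

definition on_first_three :: "real \<Rightarrow> real \<Rightarrow> real \<Rightarrow> nat \<Rightarrow> real" where
  "on_first_three a b c i = (if i = 1 then a else if i = 2 then b else if i = 3 then c else 1)"

lemma on_first_three_in:
  "a \<in> {0..1} \<Longrightarrow> b \<in> {0..1} \<Longrightarrow> c \<in> {0..1} \<Longrightarrow> on_first_three a b c \<in> {1..n} \<rightarrow> {0..1}"
  by (auto simp: on_first_three_def)

lemma on_first_three_upd:
  "on_first_three a b c = (on_first_three 0 b c)(1 := a)"
  "on_first_three a b c = (on_first_three a 0 c)(2 := b)"
  "on_first_three a b c = (on_first_three a b 0)(3 := c)"
  by (auto simp: on_first_three_def)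

text \<open>The alternating sum is the probability of a half-open box in the first three
  coordinates, with the others bounded by 1. It is expanded by taking differences in one coordinate
  at a time.\<close>

lemma is_copula_box_nonneg:
  assumes C: "is_copula n C" and n: "3 \<le> n"
    and a: "0 \<le> a" "a \<le> a'" "a' \<le> 1" and b: "0 \<le> b" "b \<le> b'" "b' \<le> 1"
    and c: "0 \<le> c" "c \<le> c'" "c' \<le> 1"
  defines "D \<equiv> \<lambda>a b c. C (on_first_three a b c)"
  shows "0 \<le> D a' b' c' - D a' b' c - D a' b c' - D a b' c' + D a' b c + D a b' c + D a b c' - D a b c"
proof -
  obtain N where N: "prob_space N"
    "\<And>u. u \<in> {1..n} \<rightarrow> {0..1} \<Longrightarrow> C u = joint_cdf N n (\<lambda>i x. x i) u"
    "\<And>i. i \<in> {1..n} \<Longrightarrow> (\<lambda>x. x i) \<in> borel_measurable N"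
    using is_copula_representation[OF C] by metis
  interpret prob_space N by fact
  define S where "S = {x \<in> space N. \<forall>j\<in>{1..n} - {1,2,3}. x j \<le> 1}"
  define F where "F i r = {x \<in> space N. x i \<le> r}" for i r
  have S [measurable]: "S \<in> events"
    unfolding S_def by (rule sets.sets_Collect_finite_All) (use N(3) in auto)
  have F [measurable]: "F i r \<in> events" if "i \<in> {1..n}" for i r
    using N(3)[OF that] by (simp add: F_def)
  have F123 [measurable]: "F 1 r \<in> events" "F 2 r \<in> events" "F 3 r \<in> events" for r
    using n by (auto intro!: F)
  have D: "D a b c = prob (S \<inter> F 1 a \<inter> F 2 b \<inter> F 3 c)"
    if "a \<in> {0..1}" "b \<in> {0..1}" "c \<in> {0..1}" for a b c
  proof -
    have "{x \<in> space N. \<forall>j\<in>{1..n}. x j \<le> on_first_three a b c j} = S \<inter> F 1 a \<inter> F 2 b \<inter> F 3 c"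
      using n by (auto simp: S_def F_def on_first_three_def split: if_splits)
    then show ?thesis unfolding D_def N(2)[OF on_first_three_in[OF that]] by (simp add: joint_cdf_def)
  qed
  have diff: "prob (T \<inter> (F i s - F i r)) = prob (T \<inter> F i s) - prob (T \<inter> F i r)"
    if [measurable]: "T \<in> events" and i: "i \<in> {1..n}" and "r \<le> s" for T i r s
  proof -
    have "T \<inter> (F i s - F i r) = (T \<inter> F i s) - (T \<inter> F i r)" by auto
    also have "prob \<dots> = prob (T \<inter> F i s) - prob (T \<inter> F i r)"
      using \<open>r \<le> s\<close> F[OF i] by (intro finite_measure_Diff) (auto simp: F_def)
    finally show ?thesis .
  qed
  have mem: "1 \<in> {1..n}" "2 \<in> {1..n}" "3 \<in> {1..n}" using n by auto
  let ?A = "F 1 a' - F 1 a" and ?B = "F 2 b' - F 2 b" and ?C = "F 3 c' - F 3 c"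
  have 3: "prob (S \<inter> ?A \<inter> ?B \<inter> ?C) = prob (S \<inter> ?A \<inter> ?B \<inter> F 3 c') - prob (S \<inter> ?A \<inter> ?B \<inter> F 3 c)"
    by (rule diff) (use mem c in auto)
  have 2: "prob (S \<inter> W \<inter> ?B \<inter> V) = prob (S \<inter> W \<inter> F 2 b' \<inter> V) - prob (S \<inter> W \<inter> F 2 b \<inter> V)"
    if [measurable]: "V \<in> events" "W \<in> events" for V W
    using diff[of "S \<inter> W \<inter> V" 2 b b'] mem b by (simp add: Int_commute Int_left_commute Int_assoc)
  have 1: "prob (S \<inter> ?A \<inter> W \<inter> V) = prob (S \<inter> F 1 a' \<inter> W \<inter> V) - prob (S \<inter> F 1 a \<inter> W \<inter> V)"
    if [measurable]: "V \<in> events" "W \<in> events" for V W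
    using diff[of "S \<inter> W \<inter> V" 1 a a'] mem a by (simp add: Int_commute Int_left_commute Int_assoc)
  have box: "D a' b' c' - D a' b' c - D a' b c' - D a b' c' + D a' b c + D a b' c + D a b c' - D a b c
      = prob (S \<inter> ?A \<inter> ?B \<inter> ?C)"
    using a b c by (simp add: 3 2 1 D F123 sets.Diff del: One_nat_def)
  show ?thesis unfolding box by (rule measure_nonneg)
qed

context inverse_generator_function
begin

text \<open>Parametrising the coordinates by \<psi> avoids the value \<infinity> of the generator.
  If a coordinate is 0, \<open>C u\<close> is 0 by \<open>is_copula_eq_0\<close>, and \<psi> of the
  sum lies between 0 and that coordinate.\<close>

lemma archimedean_value:
  assumes C: "is_copula n C"
    and arch: "\<And>u. u \<in> {1..n} \<rightarrow> {0..1} \<Longrightarrow> C u = extend_inverse \<psi> (\<Sum>i\<in>{1..n}. generator_of \<psi> (u i))"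
    and y: "\<And>i. i \<in> {1..n} \<Longrightarrow> 0 \<le> y i" and u: "\<And>i. i \<in> {1..n} \<Longrightarrow> u i = \<psi> (y i)"
  shows "C u = \<psi> (\<Sum>i\<in>{1..n}. y i)"
proof -
  have mem: "u \<in> {1..n} \<rightarrow> {0..1}" using y u psi_nonneg psi_le_1 by auto
  show ?thesis
  proof (cases "\<exists>i\<in>{1..n}. u i = 0")
    case True
    then obtain i where i: "i \<in> {1..n}" "u i = 0" by blast
    have "\<psi> (\<Sum>i\<in>{1..n}. y i) \<le> \<psi> (y i)"
      using y i by (intro antimono member_le_sum) auto
    moreover have "0 \<le> \<psi> (\<Sum>i\<in>{1..n}. y i)" using y by (intro psi_nonneg sum_nonneg)
    ultimately show ?thesis using is_copula_eq_0[OF C mem i] i u by auto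
  next
    case False
    have "generator_of \<psi> (u i) = ennreal (y i)" if i: "i \<in> {1..n}" for i
    proof -
      have "0 < \<psi> (y i)" using False i u y psi_nonneg[of "y i"] by force
      then show ?thesis using \<phi>_psi[of "y i"] i u y by (simp add: generator_of_def \<phi>_def)
    qed
    then have "C u = extend_inverse \<psi> (\<Sum>i\<in>{1..n}. ennreal (y i))"
      unfolding arch[OF mem] by (intro arg_cong[where f = "extend_inverse \<psi>"] sum.cong) auto
    also have "(\<Sum>i\<in>{1..n}. ennreal (y i)) = ennreal (\<Sum>i\<in>{1..n}. y i)"
      using y by (intro sum_ennreal) auto
    finally show ?thesis using sum_nonneg[of "{1..n}" y] y by (simp add: extend_inverse_def)
  qed
qed

lemma sum_first_three:
  fixes n :: nat
  assumes "3 \<le> n"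
  shows "(\<Sum>i\<in>{1..n}. if i = 1 then a else if i = 2 then b else if i = 3 then c else 0) = a + b + (c :: real)"
proof -
  have "(\<Sum>i\<in>{1..n}. if i = 1 then a else if i = 2 then b else if i = 3 then c else 0)
      = (\<Sum>i\<in>{1,2,3::nat}. if i = 1 then a else if i = 2 then b else if i = 3 then c else 0)"
    using assms by (intro sum.mono_neutral_right) auto
  then show ?thesis by simp
qed

lemma archimedean_value_three:
  assumes "is_copula n C" "3 \<le> n"
    and "\<And>u. u \<in> {1..n} \<rightarrow> {0..1} \<Longrightarrow> C u = extend_inverse \<psi> (\<Sum>i\<in>{1..n}. generator_of \<psi> (u i))"
    and "0 \<le> a" "0 \<le> b" "0 \<le> c"
  shows "C (on_first_three (\<psi> a) (\<psi> b) (\<psi> c)) = \<psi> (a + b + c)"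
  using archimedean_value[OF assms(1,3), of "\<lambda>i. if i = 1 then a else if i = 2 then b else if i = 3 then c else 0"]
    assms sum_first_three[OF assms(2), of a b c]
  by (simp add: on_first_three_def)

text \<open>The third difference is minus the volume of the box with sides
  \<open>[\<psi> (a + h), \<psi> a]\<close>, \<open>[\<psi> k, 1]\<close> and
  \<open>[\<psi> l, 1]\<close>.\<close>

lemma archimedean_copula_three_monotone:
  assumes C: "is_copula n C" and n: "3 \<le> n"
    and arch: "\<And>u. u \<in> {1..n} \<rightarrow> {0..1} \<Longrightarrow> C u = extend_inverse \<psi> (\<Sum>i\<in>{1..n}. generator_of \<psi> (u i))"
  shows "three_monotone_inverse_generator \<psi>"
proof
  fix a h k l :: real assume *: "0 \<le> a" "0 \<le> h" "0 \<le> k" "0 \<le> l"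
  have val: "C (on_first_three (\<psi> a) (\<psi> b) (\<psi> c)) = \<psi> (a + b + c)"
    if "0 \<le> a" "0 \<le> b" "0 \<le> c" for a b c
    by (rule archimedean_value_three) (use C n arch that in auto)
  show "\<psi> (a + h + k + l) - \<psi> (a + h + k) - \<psi> (a + h + l) - \<psi> (a + k + l)
      + \<psi> (a + h) + \<psi> (a + k) + \<psi> (a + l) - \<psi> a \<le> 0"
    using is_copula_box_nonneg[OF C n, of "\<psi> (a + h)" "\<psi> a" "\<psi> k" "\<psi> 0" "\<psi> l" "\<psi> 0"] *
    by (simp add: val psi_nonneg psi_le_1 antimono del: psi_0)
qed

end

text \<open>The coordinates outside \<open>J\<close> are released one by one by letting
  \<open>x k\<close> tend to infinity. The probabilities converge by continuity from below; the
  copula values converge because the marginal tends to 1 and \<open>C\<close> is Lipschitz in each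
  coordinate.\<close>

lemma copula_marginal:
  fixes X :: "nat \<Rightarrow> 'a \<Rightarrow> real"
  assumes M: "prob_space M" and X: "\<And>i. i \<in> {1..n} \<Longrightarrow> X i \<in> borel_measurable M"
    and C: "has_copula M n X C" and J: "J \<subseteq> {1..n}"
  shows "measure M {\<omega> \<in> space M. \<forall>i\<in>J. X i \<omega> \<le> x i}
    = C (\<lambda>i. if i \<in> J then marginal_cdf M (X i) (x i) else 1)"
proof -
  interpret prob_space M by fact
  define F where "F i = marginal_cdf M (X i)" for i
  have dist: "real_distribution (distr M borel (X i))" if "i \<in> {1..n}" for i
    using X[OF that] by simp
  have F01: "F i r \<in> {0..1}" if "i \<in> {1..n}" for i r
    unfolding F_def using real_distribution.cdf_bounded_prob[OF dist[OF that]]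
    by (simp add: cdf_def)
  have cop: "is_copula n C" using C by (simp add: has_copula_def)
  have "measure M {\<omega> \<in> space M. \<forall>i\<in>{1..n} - K. X i \<omega> \<le> x i} = C (\<lambda>i. if i \<in> {1..n} - K then F i (x i) else 1)"
    if "finite K" "K \<subseteq> {1..n}" for K x
    using that
  proof (induction K arbitrary: x rule: finite_induct)
    case empty
    have "measure M {\<omega> \<in> space M. \<forall>i\<in>{1..n}. X i \<omega> \<le> x i} = C (\<lambda>i. F i (x i))"
      using C by (simp add: has_copula_def joint_cdf_def F_def)
    also have "\<dots> = C (\<lambda>i. if i \<in> {1..n} then F i (x i) else 1)"
      by (rule is_copula_cong[OF cop]) (use F01 in auto)
    finally show ?case by simp
  next
    case (insert k K)
    define U where "U i = (if i \<in> {1..n} - insert k K then F i (x i) else 1)" for i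
    have U: "U \<in> {1..n} \<rightarrow> {0..1}" using F01 by (auto simp: U_def)
    have k: "k \<in> {1..n}" "k \<notin> K" using insert by auto
    have upd: "(\<lambda>i. if i \<in> {1..n} - K then F i ((x(k := m)) i) else 1) = U(k := F k m)" for m
      using k by (auto simp: U_def fun_eq_iff)
    have step: "measure M {\<omega> \<in> space M. \<forall>i\<in>{1..n} - K. X i \<omega> \<le> (x(k := m)) i} = C (U(k := F k m))" for m
    proof -
      have "K \<subseteq> {1..n}" using insert.prems by simp
      from insert.IH[OF this, of "x(k := m)"] show ?thesis unfolding upd .
    qed
    have "(\<lambda>m. measure M {\<omega> \<in> space M. \<forall>i\<in>{1..n} - K. X i \<omega> \<le> (x(k := real m)) i})
        \<longlonglongrightarrow> measure M (\<Union>m. {\<omega> \<in> space M. \<forall>i\<in>{1..n} - K. X i \<omega> \<le> (x(k := real m)) i})"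
    proof (rule finite_Lim_measure_incseq)
      show "range (\<lambda>m. {\<omega> \<in> space M. \<forall>i\<in>{1..n} - K. X i \<omega> \<le> (x(k := real m)) i}) \<subseteq> events"
        by (intro image_subsetI sets.sets_Collect_finite_All) (use X in auto)
      show "incseq (\<lambda>m. {\<omega> \<in> space M. \<forall>i\<in>{1..n} - K. X i \<omega> \<le> (x(k := real m)) i})"
        by (auto simp: incseq_def intro: order_trans split: if_splits)
    qed
    also have "(\<Union>m. {\<omega> \<in> space M. \<forall>i\<in>{1..n} - K. X i \<omega> \<le> (x(k := real m)) i})
        = {\<omega> \<in> space M. \<forall>i\<in>{1..n} - insert k K. X i \<omega> \<le> x i}"
    proof (intro set_eqI iffI)
      fix \<omega> assume \<omega>: "\<omega> \<in> {\<omega> \<in> space M. \<forall>i\<in>{1..n} - insert k K. X i \<omega> \<le> x i}"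
      obtain m where "X k \<omega> \<le> real m" using real_arch_simple by blast
      with \<omega> show "\<omega> \<in> (\<Union>m. {\<omega> \<in> space M. \<forall>i\<in>{1..n} - K. X i \<omega> \<le> (x(k := real m)) i})" by auto
    next
      fix \<omega> assume "\<omega> \<in> (\<Union>m. {\<omega> \<in> space M. \<forall>i\<in>{1..n} - K. X i \<omega> \<le> (x(k := real m)) i})"
      then obtain m where m: "\<omega> \<in> space M" "\<And>i. i \<in> {1..n} - K \<Longrightarrow> X i \<omega> \<le> (x(k := real m)) i" by blast
      have "X i \<omega> \<le> x i" if "i \<in> {1..n} - insert k K" for i
        using m(2)[of i] that by auto
      then show "\<omega> \<in> {\<omega> \<in> space M. \<forall>i\<in>{1..n} - insert k K. X i \<omega> \<le> x i}" using m(1) by blast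
    qed
    finally have "(\<lambda>m. C (U(k := F k (real m)))) \<longlonglongrightarrow> measure M {\<omega> \<in> space M. \<forall>i\<in>{1..n} - insert k K. X i \<omega> \<le> x i}"
      unfolding step .
    moreover have "(\<lambda>m. C (U(k := F k (real m)))) \<longlonglongrightarrow> C (U(k := 1))"
    proof -
      have "(\<lambda>m. 1 - F k (real m)) \<longlonglongrightarrow> 1 - 1"
        unfolding F_def by (intro tendsto_intros real_distribution.cdf_lim_infty_prob dist k)
      then have lim0: "(\<lambda>m. 1 - F k (real m)) \<longlonglongrightarrow> 0" by simp
      have bound: "\<bar>C (U(k := 1)) - C (U(k := F k (real m)))\<bar> \<le> 1 - F k (real m)" for m
        using F01[OF k(1), of "real m"] by (intro is_copula_lipschitz[OF cop k(1) U]) simp_all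
      have "(\<lambda>m. C (U(k := F k (real m))) - C (U(k := 1))) \<longlonglongrightarrow> 0"
      proof (rule Lim_null_comparison[OF _ lim0])
        show "\<forall>\<^sub>F m in sequentially. norm (C (U(k := F k (real m))) - C (U(k := 1))) \<le> 1 - F k (real m)"
          using bound by (intro always_eventually allI) (simp only: real_norm_def abs_minus_commute)
      qed
      then show ?thesis by (rule LIM_zero_cancel)
    qed
    ultimately have "measure M {\<omega> \<in> space M. \<forall>i\<in>{1..n} - insert k K. X i \<omega> \<le> x i} = C (U(k := 1))"
      by (rule LIMSEQ_unique)
    also have "U(k := 1) = U" by (auto simp: U_def)
    finally show ?case by (simp add: U_def[abs_def])
  qed
  from this[of "{1..n} - J" x]
  have "measure M {\<omega> \<in> space M. \<forall>i\<in>{1..n} - ({1..n} - J). X i \<omega> \<le> x i}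
      = C (\<lambda>i. if i \<in> {1..n} - ({1..n} - J) then F i (x i) else 1)" by simp
  moreover have "{1..n} - ({1..n} - J) = J" using J by blast
  ultimately show ?thesis by (simp only: F_def)
qed

section \<open>From the Markov property to an exponential generator\<close>

context three_monotone_inverse_generator
begin

text \<open>\<open>E s u\<close> stands for \<open>C(u, \<psi> s, 1)\<close>, or its analogue with \<open>u\<close> in the third coordinate.\<close>

lemma functional_equation_from_range:
  assumes \<mu>: "real_distribution \<mu>"
    and affine: "\<And>s a b t. 0 \<le> s \<Longrightarrow> 0 \<le> a \<Longrightarrow> a < b \<Longrightarrow> b \<le> 1 \<Longrightarrow> {a<..<b} \<inter> range (cdf \<mu>) = {} \<Longrightarrow>
      t \<in> {0..1} \<Longrightarrow> E s ((1 - t) * a + t * b) = (1 - t) * E s a + t * E s b"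
    and E: "\<And>s u. 0 \<le> s \<Longrightarrow> 0 < u \<Longrightarrow> u \<le> 1 \<Longrightarrow> E s u = \<psi> (\<phi> u + s)" "\<And>s. 0 \<le> s \<Longrightarrow> E s 0 = 0"
    and y: "0 < y" and z: "0 \<le> z" and x: "0 < x"
    and eq: "\<And>t. 0 < cdf \<mu> t \<Longrightarrow> \<gamma> (\<phi> (cdf \<mu> t) + z + y) * \<gamma> y = \<gamma> (\<phi> (cdf \<mu> t) + y) * \<gamma> (z + y)"
  shows "\<gamma> (x + z + y) * \<gamma> y = \<gamma> (x + y) * \<gamma> (z + y)"
proof (cases "\<psi> x = 0")
  case True
  have "\<gamma> (x + s) = 0" if "0 \<le> s" for s
    using antimono[of x "x + s"] psi_nonneg[of "x + s"] True x that by (intro \<gamma>_eq_0) auto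
  from this[of "z + y"] this[of y] show ?thesis using y z by (simp add: add.assoc)
next
  case False
  interpret cdf_distribution \<mu> using \<mu> by (simp add: cdf_distribution_def)
  \<comment> \<open>Minus the derivative of \<open>E\<close> in \<open>s\<close>. The value at
    \<open>u = 0\<close> is set by hand because \<open>E\<close> is identically 0 there and
    \<open>\<phi> 0\<close> carries no meaning.\<close>
  define G where "G s u = (if u = 0 then 0 else \<gamma> (\<phi> u + s))" for s u
  have E_deriv: "((\<lambda>s. E s u) has_real_derivative - G s u) (at s)" if "0 < s" "0 \<le> u" "u \<le> 1" for s u
  proof (cases "u = 0")
    case True
    have "((\<lambda>s. 0) has_real_derivative 0) (at s)" by simp
    then have "((\<lambda>s. E s u) has_real_derivative 0) (at s)"
      by (rule has_field_derivative_transform_within_open[of _ _ _ "{0<..}"]) (use that True E(2) in auto)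
    then show ?thesis by (simp add: G_def True)
  next
    case False
    have "((\<lambda>s. \<psi> (\<phi> u + s)) has_real_derivative - \<gamma> (\<phi> u + s) * 1) (at s)"
      using \<phi>_nonneg[of u] that False
      by (intro DERIV_chain2[OF psi_deriv]) (auto intro!: derivative_eq_intros)
    then have "((\<lambda>s. E s u) has_real_derivative - \<gamma> (\<phi> u + s) * 1) (at s)"
      by (rule has_field_derivative_transform_within_open[of _ _ _ "{0<..}"]) (use that False E(1) in auto)
    then show ?thesis using False by (simp add: G_def)
  qed
  \<comment> \<open>Affinity of \<open>E s\<close> on a gap is an identity in \<open>s\<close>;
    differentiating it passes the affinity on to \<open>G s\<close>.\<close>
  have G_affine: "G s ((1 - t) * a + t * b) = (1 - t) * G s a + t * G s b"
    if s: "0 < s" and ab: "0 \<le> a" "a < b" "b \<le> 1" "{a<..<b} \<inter> range (cdf \<mu>) = {}" "t \<in> {0..1}" for s a b t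
  proof -
    have mem: "0 \<le> (1 - t) * a + t * b" "(1 - t) * a + t * b \<le> 1"
      using ab convex_bound_le[of a 1 b "1 - t" t] by auto
    have "((\<lambda>s. (1 - t) * E s a + t * E s b) has_real_derivative (1 - t) * - G s a + t * - G s b) (at s)"
      by (intro DERIV_add DERIV_cmult E_deriv) (use ab s in auto)
    then have "((\<lambda>s. E s ((1 - t) * a + t * b)) has_real_derivative (1 - t) * - G s a + t * - G s b) (at s)"
      by (rule has_field_derivative_transform_within_open[of _ _ _ "{0<..}"]) (use s affine[OF _ ab] in auto)
    from DERIV_unique[OF this E_deriv[OF s mem]] show ?thesis by (simp add: algebra_simps)
  qed
  have G_left: "(G s \<longlongrightarrow> G s a) (at_left a)" if "0 < s" "0 < a" "a < 1" for s a
  proof -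
    have "\<forall>\<^sub>F u in at_left a. u \<in> {0<..<a}" using that by (intro eventually_at_left_real) auto
    then have "\<forall>\<^sub>F u in at_left a. G s u = \<gamma> (s + \<phi> u)"
      by eventually_elim (auto simp: G_def add.commute)
    moreover have "((\<lambda>u. \<gamma> (s + \<phi> u)) \<longlongrightarrow> \<gamma> (s + \<phi> a)) (at_left a)"
      using \<gamma>_shift_isCont[of s a] that by (simp add: isCont_def filterlim_at_split)
    ultimately show ?thesis
      using that by (simp add: G_def add.commute tendsto_cong)
  qed
  \<comment> \<open>The difference of the two sides of the claim as a function of
    \<open>u = \<psi> x\<close>, to be shown zero off the range as well.\<close>
  define A where "A u = G (z + y) u * \<gamma> y - G y u * \<gamma> (z + y)" for u
  have "A (\<psi> x) = 0"
  proof (rule eq_0_if_eq_0_on_range_cdf[where A = A])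
    show "A (cdf \<mu> t) = 0" for t
      using eq[of t] cdf_nonneg[of t] by (cases "cdf \<mu> t = 0") (auto simp: A_def G_def add.assoc)
    show "(A \<longlongrightarrow> A a) (at_left a)" if "0 < a" "a < 1" for a
      unfolding A_def by (intro tendsto_intros G_left) (use that y z in auto)
    show "A ((1 - t) * a + t * b) = (1 - t) * A a + t * A b"
      if ab: "0 \<le> a" "a < b" "b \<le> 1" "{a<..<b} \<inter> range (cdf \<mu>) = {}" "t \<in> {0..1}" for a b t
    proof -
      have "0 < z + y" using y z by simp
      show ?thesis unfolding A_def G_affine[OF y ab] G_affine[OF \<open>0 < z + y\<close> ab] by (simp add: algebra_simps)
    qed
    show "0 < \<psi> x" using False psi_nonneg[of x] x by simp
    then show "\<psi> x < 1" using strict[of 0 x] x by simp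
  qed
  then show ?thesis using False psi_nonneg[of x] x by (simp add: A_def G_def add.assoc)
qed

text \<open>The functional equation is first derived with \<open>x\<close> and \<open>z\<close>
  replaced by values of \<open>\<phi>\<close> on the ranges of the first and third marginals, for
  every \<open>y\<close>. Then the first and next the third coordinate is freed by
  \<open>functional_equation_from_range\<close>.\<close>

lemma markov_archimedean_exponential:
  fixes X :: "nat \<Rightarrow> 'a \<Rightarrow> real"
  assumes M: "prob_space M" and n: "3 \<le> n" and X: "\<And>i. i \<in> {1..n} \<Longrightarrow> X i \<in> borel_measurable M"
    and markov: "markov_chain M n X" and C: "has_copula M n X C"
    and arch: "\<And>u. u \<in> {1..n} \<rightarrow> {0..1} \<Longrightarrow> C u = extend_inverse \<psi> (\<Sum>i\<in>{1..n}. generator_of \<psi> (u i))"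
  obtains r where "\<And>x. 0 \<le> x \<Longrightarrow> \<psi> x = exp (- r * x)"
proof -
  interpret prob_space M by fact
  have cop: "is_copula n C" using C by (simp add: has_copula_def)
  define F where "F i = marginal_cdf M (X i)" for i
  have mem3: "1 \<in> {1..n}" "2 \<in> {1..n}" "3 \<in> {1..n}" using n by auto
  have dist: "real_distribution (distr M borel (X i))" if "i \<in> {1..n}" for i
    using X[OF that] by simp
  have F01: "0 \<le> F i r" "F i r \<le> 1" if "i \<in> {1..n}" for i r
    unfolding F_def using real_distribution.cdf_bounded_prob[OF dist[OF that]]
    by (simp_all add: cdf_def)
  define D where "D a b c = C (on_first_three a b c)" for a b c
  have D_psi: "D (\<psi> a) (\<psi> b) (\<psi> c) = \<psi> (a + b + c)" if "0 \<le> a" "0 \<le> b" "0 \<le> c" for a b c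
    unfolding D_def by (rule archimedean_value_three) (use cop n arch that in auto)
  have D_pos: "D a b c = \<psi> (\<phi> a + \<phi> b + \<phi> c)"
    if "0 < a" "a \<le> 1" "0 < b" "b \<le> 1" "0 < c" "c \<le> 1" for a b c
    using D_psi[of "\<phi> a" "\<phi> b" "\<phi> c"] that by (simp add: \<phi>_nonneg)
  have D_0: "D a b c = 0"
    if abc: "a \<in> {0..1}" "b \<in> {0..1}" "c \<in> {0..1}" and zero: "a = 0 \<or> b = 0 \<or> c = 0" for a b c
  proof -
    have "\<exists>i\<in>{1, 2, 3}. on_first_three a b c i = 0"
      using zero by (auto simp: on_first_three_def)
    then obtain i where "i \<in> {1, 2, 3}" "on_first_three a b c i = 0" by blast
    then show ?thesis
      unfolding D_def using n by (intro is_copula_eq_0[OF cop on_first_three_in[OF abc], of i]) auto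
  qed
  have D_upd: "D a b c = C ((on_first_three 0 b c)(1 := a))" "D a b c = C ((on_first_three a 0 c)(2 := b))"
    "D a b c = C ((on_first_three a b 0)(3 := c))" for a b c
    unfolding D_def using on_first_three_upd[of a b c] by simp_all
  have affine: "C (u(i := (1 - t) * a + t * b)) = (1 - t) * C (u(i := a)) + t * C (u(i := b))"
    if "i \<in> {1..n}" "u \<in> {1..n} \<rightarrow> {0..1}" "0 \<le> a" "a < b" "b \<le> 1" "{a<..<b} \<inter> range (F i) = {}" "t \<in> {0..1}"
    for u i a b t
    using C that unfolding has_copula_def F_def by blast
  have D_left: "((\<lambda>v. D a v c) \<longlongrightarrow> D a b c) (at_left b)"
    if abc: "a \<in> {0..1}" "c \<in> {0..1}" "0 < b" "b < 1" for a b c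
  proof -
    have "\<forall>\<^sub>F v in at_left b. v \<in> {0<..<b}" using abc by (intro eventually_at_left_real) auto
    then have ev: "\<forall>\<^sub>F v in at_left b. norm (D a v c - D a b c) \<le> norm (b - v)"
    proof eventually_elim
      case (elim v)
      have "\<bar>D a b c - D a v c\<bar> \<le> b - v"
        unfolding D_upd(2) using abc elim mem3
        by (intro is_copula_lipschitz[OF cop] on_first_three_in) auto
      then show ?case by simp
    qed
    have "((\<lambda>v. b - v) \<longlongrightarrow> b - b) (at_left b)" by (intro tendsto_intros)
    then have "((\<lambda>v. b - v) \<longlongrightarrow> 0) (at_left b)" by simp
    then show ?thesis
      using Lim_null_comparison[OF ev tendsto_norm_zero] by (simp add: LIM_zero_iff)
  qed
  have marg: "measure M {\<omega> \<in> space M. \<forall>i\<in>J. X i \<omega> \<le> w i}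
      = D (if 1 \<in> J then F 1 (w 1) else 1) (if 2 \<in> J then F 2 (w 2) else 1) (if 3 \<in> J then F 3 (w 3) else 1)"
    if J: "J \<subseteq> {1, 2, 3}" for J w
  proof -
    have "measure M {\<omega> \<in> space M. \<forall>i\<in>J. X i \<omega> \<le> w i} = C (\<lambda>i. if i \<in> J then F i (w i) else 1)"
      unfolding F_def using M X C by (rule copula_marginal) (use J n in auto)
    also have "(\<lambda>i. if i \<in> J then F i (w i) else 1) = on_first_three (if 1 \<in> J then F 1 (w 1) else 1)
        (if 2 \<in> J then F 2 (w 2) else 1) (if 3 \<in> J then F 3 (w 3) else 1)"
      using J by (auto simp: on_first_three_def fun_eq_iff)
    finally show ?thesis by (simp only: D_def)
  qed
  have on_range: "\<gamma> (\<phi> (F 1 x) + \<phi> (F 3 z) + y) * \<gamma> y = \<gamma> (\<phi> (F 1 x) + y) * \<gamma> (\<phi> (F 3 z) + y)"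
    if pos: "0 < F 1 x" "0 < F 3 z" "0 < y" for x y z
  proof -
    interpret Q: cdf_distribution "distr M borel (X 2)" using dist[OF mem3(2)] by (simp add: cdf_distribution_def)
    have le1: "F 1 x \<le> 1" "F 3 z \<le> 1" using F01 mem3 by auto
    obtain p q where p: "p \<in> borel_measurable borel" "\<And>t. 0 \<le> p t" "\<And>t. p t \<le> 1"
      and q: "q \<in> borel_measurable borel" "\<And>t. 0 \<le> q t" "\<And>t. q t \<le> 1"
      and P12: "\<And>t. measure M {\<omega> \<in> space M. X 1 \<omega> \<le> x \<and> X 2 \<omega> \<le> t}
          = (\<integral>s. indicator {..t} s * p s \<partial>distr M borel (X 2))"
      and P23: "\<And>t. measure M {\<omega> \<in> space M. X 2 \<omega> \<le> t \<and> X 3 \<omega> \<le> z}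
          = (\<integral>s. indicator {..t} s * q s \<partial>distr M borel (X 2))"
      and P123: "\<And>t. measure M {\<omega> \<in> space M. X 1 \<omega> \<le> x \<and> X 2 \<omega> \<le> t \<and> X 3 \<omega> \<le> z}
          = (\<integral>s. indicator {..t} s * (p s * q s) \<partial>distr M borel (X 2))"
      by (rule markov_chain_densities[OF X[OF mem3(1)] X[OF mem3(2)] X[OF mem3(3)] n markov]) (rule that)
    \<comment> \<open>The quantile pull-back gives the integral up to every \<open>v\<close> in the
      open unit interval, even where \<open>v\<close> is not a value of \<open>F 2\<close>.\<close>
    have K: "(LINT s:{0<..v}|lborel. Q.quantile_comp h s) = D a v c"
      if h: "h \<in> borel_measurable borel" "\<And>t. 0 \<le> h t" "\<And>t. h t \<le> 1"
        and ac: "a \<in> {0..1}" "c \<in> {0..1}" and v: "0 < v" "v < 1"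
        and int: "\<And>t. (\<integral>s. indicator {..t} s * h s \<partial>distr M borel (X 2)) = D a (F 2 t) c" for h a c v
    proof (rule Q.quantile_integral_eq[where K = "\<lambda>v. D a v c", OF h])
      show "D a ((1 - t) * l + t * r) c = (1 - t) * D a l c + t * D a r c"
        if "0 \<le> l" "l < r" "r \<le> 1" "{l<..<r} \<inter> range (cdf (distr M borel (X 2))) = {}" "t \<in> {0..1}" for l r t
        unfolding D_upd(2) using that ac mem3
        by (intro affine on_first_three_in) (auto simp: F_def)
    qed (use int D_left ac v in \<open>auto simp: F_def\<close>)
    define w where "w t = on_first_three x t z" for t
    have w: "w t 1 = x" "w t 2 = t" "w t 3 = z" for t by (simp_all add: w_def on_first_three_def)
    have "{\<omega> \<in> space M. X 1 \<omega> \<le> x \<and> X 2 \<omega> \<le> t} = {\<omega> \<in> space M. \<forall>i\<in>{1,2}. X i \<omega> \<le> w t i}" for t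
      using w by auto
    then have int12: "(\<integral>s. indicator {..t} s * p s \<partial>distr M borel (X 2)) = D (F 1 x) (F 2 t) 1" for t
      using P12[of t] marg[of "{1,2}" "w t"] w by simp
    have "{\<omega> \<in> space M. X 2 \<omega> \<le> t \<and> X 3 \<omega> \<le> z} = {\<omega> \<in> space M. \<forall>i\<in>{2,3}. X i \<omega> \<le> w t i}" for t
      using w by auto
    then have int23: "(\<integral>s. indicator {..t} s * q s \<partial>distr M borel (X 2)) = D 1 (F 2 t) (F 3 z)" for t
      using P23[of t] marg[of "{2,3}" "w t"] w by simp
    have "{\<omega> \<in> space M. X 1 \<omega> \<le> x \<and> X 2 \<omega> \<le> t \<and> X 3 \<omega> \<le> z}
        = {\<omega> \<in> space M. \<forall>i\<in>{1,2,3}. X i \<omega> \<le> w t i}" for t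
      using w by auto
    then have int123: "(\<integral>s. indicator {..t} s * (p s * q s) \<partial>distr M borel (X 2)) = D (F 1 x) (F 2 t) (F 3 z)" for t
      using P123[of t] marg[of "{1,2,3}" "w t"] w by simp
    \<comment> \<open>Composition with the quantile is multiplicative, since an indicator equals its
      square; the conditional independence survives the pull-back.\<close>
    have prod: "Q.quantile_comp (\<lambda>s. p s * q s) s = Q.quantile_comp p s * Q.quantile_comp q s" for s
      by (simp add: Q.quantile_comp_def indicator_def)
    show ?thesis
    proof (rule functional_equation_if_product_densities)
      show "0 \<le> \<phi> (F 1 x)" "0 \<le> \<phi> (F 3 z)" "0 < y" using pos le1 by (auto intro: \<phi>_nonneg)
      show "Q.quantile_comp p \<in> borel_measurable borel" "Q.quantile_comp q \<in> borel_measurable borel"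
        using p q by (simp_all add: Q.quantile_comp_measurable)
      show "0 \<le> Q.quantile_comp p v" "Q.quantile_comp p v \<le> 1" "0 \<le> Q.quantile_comp q v" "Q.quantile_comp q v \<le> 1" for v
        using Q.quantile_comp_bounds p q by blast+
      fix v :: real assume v: "0 < v" "v < 1"
      show "(LINT s:{0<..v}|lborel. Q.quantile_comp p s) = \<psi> (\<phi> (F 1 x) + \<phi> v)"
        using K[OF p _ _ v int12] pos le1 v by (simp add: D_pos)
      show "(LINT s:{0<..v}|lborel. Q.quantile_comp q s) = \<psi> (\<phi> (F 3 z) + \<phi> v)"
        using K[OF q _ _ v int23] pos le1 v by (simp add: D_pos add.commute)
      show "(LINT s:{0<..v}|lborel. Q.quantile_comp p s * Q.quantile_comp q s) = \<psi> (\<phi> (F 1 x) + \<phi> (F 3 z) + \<phi> v)"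
        using K[OF _ _ _ _ _ v int123] pos le1 v p q by (simp add: D_pos prod mult_le_one add_ac)
    qed
  qed
  \<comment> \<open>The first coordinate is freed through the margin of coordinates 1 and 2, whose
    gap affinity comes from the interpolation convention.\<close>
  have on_range_3: "\<gamma> (x + \<phi> (F 3 z) + y) * \<gamma> y = \<gamma> (x + y) * \<gamma> (\<phi> (F 3 z) + y)"
    if pos: "0 < x" "0 < F 3 z" "0 < y" for x y z
  proof (rule functional_equation_from_range[OF dist[OF mem3(1)], where E = "\<lambda>s u. D u (\<psi> s) 1"])
    show "D ((1 - t) * a + t * b) (\<psi> s) 1 = (1 - t) * D a (\<psi> s) 1 + t * D b (\<psi> s) 1"
      if "0 \<le> s" "0 \<le> a" "a < b" "b \<le> 1" "{a<..<b} \<inter> range (cdf (distr M borel (X 1))) = {}" "t \<in> {0..1}" for s a b t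
      unfolding D_upd(1) using that mem3 psi_nonneg[of s] psi_le_1[of s]
      by (intro affine on_first_three_in) (auto simp: F_def)
    show "D u (\<psi> s) 1 = \<psi> (\<phi> u + s)" if "0 \<le> s" "0 < u" "u \<le> 1" for s u
      using D_psi[of "\<phi> u" s 0] that by (simp add: \<phi>_nonneg)
    show "D 0 (\<psi> s) 1 = 0" if "0 \<le> s" for s
      using that psi_nonneg psi_le_1 by (intro D_0) auto
    show "0 \<le> \<phi> (F 3 z)" using pos F01 mem3 by (intro \<phi>_nonneg) auto
  qed (use pos on_range in \<open>auto simp: F_def\<close>)
  show ?thesis
  proof (rule exponential_if_functional_equation)
    show "\<gamma> (x + y + z) * \<gamma> y = \<gamma> (x + y) * \<gamma> (y + z)" if pos: "0 < x" "0 < y" "0 < z" for x y z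
    proof -
      \<comment> \<open>The same transfer in the third coordinate, with \<open>x\<close> now a fixed
        parameter and \<open>z\<close> in the role of the freed variable.\<close>
      have "\<gamma> (z + x + y) * \<gamma> y = \<gamma> (z + y) * \<gamma> (x + y)"
      proof (rule functional_equation_from_range[OF dist[OF mem3(3)], where E = "\<lambda>s u. D 1 (\<psi> s) u"])
        show "D 1 (\<psi> s) ((1 - t) * a + t * b) = (1 - t) * D 1 (\<psi> s) a + t * D 1 (\<psi> s) b"
          if "0 \<le> s" "0 \<le> a" "a < b" "b \<le> 1" "{a<..<b} \<inter> range (cdf (distr M borel (X 3))) = {}" "t \<in> {0..1}" for s a b t
          unfolding D_upd(3) using that mem3 psi_nonneg[of s] psi_le_1[of s]
          by (intro affine on_first_three_in) (auto simp: F_def)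
        show "D 1 (\<psi> s) u = \<psi> (\<phi> u + s)" if "0 \<le> s" "0 < u" "u \<le> 1" for s u
          using D_psi[of 0 s "\<phi> u"] that by (simp add: \<phi>_nonneg add.commute)
        show "D 1 (\<psi> s) 0 = 0" if "0 \<le> s" for s
          using that psi_nonneg psi_le_1 by (intro D_0) auto
      next
        fix t assume "0 < cdf (distr M borel (X 3)) t"
        then show "\<gamma> (\<phi> (cdf (distr M borel (X 3)) t) + x + y) * \<gamma> y
            = \<gamma> (\<phi> (cdf (distr M borel (X 3)) t) + y) * \<gamma> (x + y)"
          using on_range_3[of x t y] pos by (simp add: F_def add_ac mult.commute)
      qed (use pos in auto)
      then show ?thesis by (simp add: add_ac mult.commute)
    qed
  qed (rule that)
qed

text \<open>The exponential turns the sum of generators into a product of the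
  \<open>\<psi> (\<phi> (u i))\<close>, which are the \<open>u i\<close>. A zero coordinate makes
  both sides vanish.\<close>

lemma archimedean_exponential_eq_prod:
  assumes cop: "is_copula n C"
    and arch: "\<And>u. u \<in> {1..n} \<rightarrow> {0..1} \<Longrightarrow> C u = extend_inverse \<psi> (\<Sum>i\<in>{1..n}. generator_of \<psi> (u i))"
    and r: "\<And>x. 0 \<le> x \<Longrightarrow> \<psi> x = exp (- r * x)" and u: "u \<in> {1..n} \<rightarrow> {0..1}"
  shows "C u = (\<Prod>i\<in>{1..n}. u i)"
proof (cases "\<exists>i\<in>{1..n}. u i = 0")
  case True
  then show ?thesis using is_copula_eq_0[OF cop u] by (auto simp: prod_zero)
next
  case False
  then have pos: "0 < u i" "u i \<le> 1" if "i \<in> {1..n}" for i using u that by (force simp: Pi_iff less_le)+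
  have "C u = \<psi> (\<Sum>i\<in>{1..n}. \<phi> (u i))"
    by (rule archimedean_value) (use cop arch pos in \<open>auto simp: \<phi>_nonneg\<close>)
  also have "\<dots> = exp (\<Sum>i\<in>{1..n}. - r * \<phi> (u i))"
    using pos by (subst r) (auto intro!: sum_nonneg \<phi>_nonneg simp: sum_distrib_left)
  also have "\<dots> = (\<Prod>i\<in>{1..n}. \<psi> (\<phi> (u i)))"
    using pos by (subst exp_sum) (auto intro!: prod.cong simp: r \<phi>_nonneg simp del: psi_\<phi>)
  also have "\<dots> = (\<Prod>i\<in>{1..n}. u i)" using pos by (intro prod.cong) auto
  finally show ?thesis .
qed

end

section \<open>Independence from product distribution functions\<close>

text \<open>Half-lines together with the whole line form an intersection-stable generator of the
  Borel sets. Components equal to the whole line impose no constraint, so the product formula is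
  required for every subset \<open>J\<close>.\<close>

lemma (in prob_space) indep_vars_if_cdf_prod:
  fixes X :: "'i \<Rightarrow> 'a \<Rightarrow> real"
  assumes I: "finite I" and X: "\<And>i. i \<in> I \<Longrightarrow> X i \<in> borel_measurable M"
    and prod: "\<And>J x. J \<subseteq> I \<Longrightarrow> prob {\<omega> \<in> space M. \<forall>i\<in>J. X i \<omega> \<le> x i} = (\<Prod>i\<in>J. cdf (distr M borel (X i)) (x i))"
  shows "indep_vars (\<lambda>_. borel) X I"
proof (cases "I = {}")
  case True
  then show ?thesis by (simp add: indep_vars_def indep_sets_def)
next
  case False
  have "indep_vars (\<lambda>_. borel) X I \<longleftrightarrow>
    (\<forall>A\<in>(\<Pi> i\<in>I. insert UNIV (range (atMost :: real \<Rightarrow> real set))).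
      prob (\<Inter>j\<in>I. X j -` A j \<inter> space M) = (\<Prod>j\<in>I. prob (X j -` A j \<inter> space M)))"
  proof (rule indep_vars_finite[OF False I])
    have "sets borel = sigma_sets UNIV (range (atMost :: real \<Rightarrow> real set))"
      by (simp add: borel_eq_atMost)
    also have "\<dots> = sigma_sets UNIV (insert UNIV (range atMost))"
      by (rule sigma_sets_eqI) (auto intro: sigma_sets.Basic sigma_sets_top)
    finally show "sets borel = sigma_sets (space borel) (insert UNIV (range (atMost :: real \<Rightarrow> real set)))" by simp
    show "Int_stable (insert UNIV (range (atMost :: real \<Rightarrow> real set)))"
      by (auto simp: Int_stable_def)
  qed (use X in auto)
  also have "\<dots>"
  proof
    fix A assume A: "A \<in> (\<Pi> i\<in>I. insert UNIV (range (atMost :: real \<Rightarrow> real set)))"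
    define J where "J = {i \<in> I. A i \<noteq> UNIV}"
    have "\<forall>i\<in>J. \<exists>x. A i = {..x}" using A by (auto simp: J_def Pi_iff)
    then obtain x where x: "\<And>i. i \<in> J \<Longrightarrow> A i = {..x i}" by metis
    have "(\<Inter>j\<in>I. X j -` A j \<inter> space M) = {\<omega> \<in> space M. \<forall>i\<in>J. X i \<omega> \<le> x i}"
    proof (intro set_eqI iffI)
      fix \<omega> assume \<omega>: "\<omega> \<in> {\<omega> \<in> space M. \<forall>i\<in>J. X i \<omega> \<le> x i}"
      have "X i \<omega> \<in> A i" if "i \<in> I" for i
        using \<omega> x[of i] that by (cases "i \<in> J") (auto simp: J_def)
      then show "\<omega> \<in> (\<Inter>j\<in>I. X j -` A j \<inter> space M)" using \<omega> by auto
    next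
      fix \<omega> assume \<omega>: "\<omega> \<in> (\<Inter>j\<in>I. X j -` A j \<inter> space M)"
      then have "X i \<omega> \<in> A i" if "i \<in> I" for i using that by blast
      then have "X i \<omega> \<le> x i" if "i \<in> J" for i
        using x[OF that] that by (force simp: J_def)
      \<comment> \<open>\<open>J\<close> may be empty; membership in \<open>space M\<close> then
        comes from an index of the nonempty set \<open>I\<close>.\<close>
      then show "\<omega> \<in> {\<omega> \<in> space M. \<forall>i\<in>J. X i \<omega> \<le> x i}" using \<omega> False by auto
    qed
    also have "prob \<dots> = (\<Prod>i\<in>J. cdf (distr M borel (X i)) (x i))"
      by (rule prod) (auto simp: J_def)
    also have "\<dots> = (\<Prod>j\<in>J. prob (X j -` A j \<inter> space M))"
      using X x by (intro prod.cong) (auto simp: cdf_def measure_distr J_def)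
    also have "\<dots> = (\<Prod>j\<in>I. prob (X j -` A j \<inter> space M))"
      using I by (intro prod.mono_neutral_left) (auto simp: J_def prob_space)
    finally show "prob (\<Inter>j\<in>I. X j -` A j \<inter> space M) = (\<Prod>j\<in>I. prob (X j -` A j \<inter> space M))" .
  qed
  finally show ?thesis by simp
qed

theorem mainTheorem1:
  fixes M :: "'a measure" and X :: "nat \<Rightarrow> 'a \<Rightarrow> real" and n :: nat
    and \<phi> :: "real \<Rightarrow> ennreal" and C :: "(nat \<Rightarrow> real) \<Rightarrow> real"
  assumes "n \<ge> 3"
    and "prob_space M"
    and "\<And>i. i \<in> {1..n} \<Longrightarrow> X i \<in> borel_measurable M"
    and "markov_chain M n X"
    and "has_copula M n X C"
    and "archimedean_copula n \<phi> C"
  shows "prob_space.indep_vars M (\<lambda>_. borel) X {1..n}"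
proof -
  interpret prob_space M by fact
  obtain \<psi> where gen: "inverse_generator \<psi>" and cop: "is_copula n C"
    and gen_of: "\<And>v. v \<in> {0..1} \<Longrightarrow> \<phi> v = generator_of \<psi> v"
    and C: "\<And>u. u \<in> {1..n} \<rightarrow> {0..1} \<Longrightarrow> C u = extend_inverse \<psi> (\<Sum>i\<in>{1..n}. \<phi> (u i))"
    using assms(6) unfolding archimedean_copula_def by blast
  have arch: "C u = extend_inverse \<psi> (\<Sum>i\<in>{1..n}. generator_of \<psi> (u i))" if "u \<in> {1..n} \<rightarrow> {0..1}" for u
  proof -
    have "(\<Sum>i\<in>{1..n}. \<phi> (u i)) = (\<Sum>i\<in>{1..n}. generator_of \<psi> (u i))"
      using that by (intro sum.cong refl gen_of) (auto simp: Pi_iff)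
    then show ?thesis using C[OF that] by simp
  qed
  have "inverse_generator_function \<psi>" by unfold_locales (rule gen)
  then have three: "three_monotone_inverse_generator \<psi>"
    by (rule inverse_generator_function.archimedean_copula_three_monotone[where n = n and C = C]) (use cop assms(1) arch in auto)
  obtain r where r: "\<And>x. 0 \<le> x \<Longrightarrow> \<psi> x = exp (- r * x)"
    by (rule three_monotone_inverse_generator.markov_archimedean_exponential
        [OF three assms(2,1,3,4,5) arch]) auto
  have prod: "C u = (\<Prod>i\<in>{1..n}. u i)" if "u \<in> {1..n} \<rightarrow> {0..1}" for u
    by (rule three_monotone_inverse_generator.archimedean_exponential_eq_prod[OF three cop arch r that])
  show ?thesis
  proof (rule indep_vars_if_cdf_prod)
    fix J x assume J: "J \<subseteq> {1..n}"
    have "prob {\<omega> \<in> space M. \<forall>i\<in>J. X i \<omega> \<le> x i} = C (\<lambda>i. if i \<in> J then marginal_cdf M (X i) (x i) else 1)"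
      by (rule copula_marginal) (use assms J in auto)
    \<comment> \<open>The copula is now the product copula, and the coordinates set to 1 contribute
      trivial factors.\<close>
    also have "\<dots> = (\<Prod>i\<in>{1..n}. if i \<in> J then marginal_cdf M (X i) (x i) else 1)"
    proof (rule prod)
      have "marginal_cdf M (X i) (x i) \<in> {0..1}" if "i \<in> {1..n}" for i
        using real_distribution.cdf_bounded_prob[OF real_distribution_distr[OF assms(3)[OF that]]]
        by (simp add: cdf_def)
      then show "(\<lambda>i. if i \<in> J then marginal_cdf M (X i) (x i) else 1) \<in> {1..n} \<rightarrow> {0..1}" by auto
    qed
    also have "\<dots> = (\<Prod>i\<in>J. marginal_cdf M (X i) (x i))"
      using J by (simp add: prod.If_cases Int_absorb1)
    finally show "prob {\<omega> \<in> space M. \<forall>i\<in>J. X i \<omega> \<le> x i} = (\<Prod>i\<in>J. marginal_cdf M (X i) (x i))" .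
  qed (use assms in auto)
qed

end
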